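(* Let $\Omega$ be a bounded domain in $\mathbb{R}^d$ ($d\ge2$) with $C^{1,\alpha}$ boundary for some $\alpha>0$. Let $v\in\mathbb{R}^d$ be a non-zero constant vector, and for $z\in\mathbb{R}^d\setminus\overline{\Omega}$ let $q_z(x)=v\cdot\nabla_z\Gamma(z-x)$, $x\in\partial\Omega$. Let $\varphi_n$, $n=1,2,\dots$, be an orthogonal system of eigenfunctions of the Neumann--Poincaré operator $\mathcal{K}^*_{\partial\Omega}$. Then for almost all $z\in\mathbb{R}^d\setminus\overline{\Omega}$, $q_z$ satisfies $$\langle q_z,\varphi_n\rangle_{\partial\Omega}\ne0\quad\text{for all } n.$$
   Context: The fundamental solution of the Laplacian is $\Gamma(x,y)=\Gamma(x-y)$ with $\Gamma(x)=\frac{1}{2\pi}\log|x|$ for $d=2$ and $\Gamma(x)=\frac{-1}{d(d-2)c_d}|x|^{2-d}$ for $d\ge3$, where $c_d$ is the volume of the unit ball in $\mathbb{R}^d$. With $n$ the outward unit normal, the Neumann--Poincaré operator on $H^{-1/2}(\partial\Omega)$ ($L^2$-Sobolev space of order $-1/2$) is $\mathcal{K}^*_{\partial\Omega}[\psi](x)=\int_{\partial\Omega}\partial_{n_x}\Gamma(x,y)\psi(y)\,dS_y$, $x\in\partial\Omega$. The single layer potential is $\mathcal{S}_{\partial\Omega}[\psi](x)=\int_{\partial\Omega}\Gamma(x,y)\psi(y)\,dS_y$. Standing assumption: $\mathcal{S}_{\partial\Omega}:H^{-1/2}(\partial\Omega)\to H^{1/2}(\partial\Omega)$ is invertible (automatic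 for $d\ge3$, achieved by dilating $\Omega$ if necessary for $d=2$), and $H^{-1/2}(\partial\Omega)$ is equipped with the inner product $\langle\varphi,\psi\rangle_{\partial\Omega}:=-\langle\varphi,\mathcal{S}_{\partial\Omega}[\psi]\rangle$, where $\langle\cdot,\cdot\rangle$ is the $H^{-1/2}$-$H^{1/2}$ pairing. With respect to this inner product $\mathcal{K}^*_{\partial\Omega}$ is compact and self-adjoint, and orthogonality of the eigenfunctions $\varphi_n$ is with respect to it.
   Formalization: The exterior of the closure of Ω is additionally assumed connected; without this the claim fails, e.g. for an annulus with a radial eigenfunction, where the pairing vanishes for every z in the hole. *)

theory Defs
  imports "HOL-Analysis.Analysis"
begin

subsection \<open>Domains with Hoelder-differentiable boundary\<close>

text \<open>
  Near every boundary point, \<open>\<Omega>\<close> is the part of a ball above the graph of a \<open>C\<^sup>1\<^sup>,\<^sup>\<alpha>\<close> function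
  over the hyperplane orthogonal to a unit vector \<open>e\<close>.  The function \<open>g\<close> is defined on the whole
  space, but only its values on that hyperplane enter.
\<close>

definition C1_holder_boundary :: "real \<Rightarrow> 'a::euclidean_space set \<Rightarrow> bool" where
  "C1_holder_boundary \<alpha> \<Omega> \<longleftrightarrow>
     (\<forall>p\<in>frontier \<Omega>. \<exists>e r g Dg C.
        norm e = 1 \<and> r > 0 \<and>
        (\<forall>w. GDERIV g w :> Dg w) \<and>
        (\<forall>w w'. norm (Dg w - Dg w') \<le> C * norm (w - w') powr \<alpha>) \<and>
        \<Omega> \<inter> ball p r = {x \<in> ball p r. x \<bullet> e > g (x - (x \<bullet> e) *\<^sub>R e)})"

definition bounded_domain :: "'a::euclidean_space set \<Rightarrow> bool" where
  "bounded_domain \<Omega> \<longleftrightarrow> open \<Omega> \<and> connected \<Omega> \<and> \<Omega> \<noteq> {} \<and> bounded \<Omega>"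

text \<open>
  The unit vector whose orthogonal hyperplane through \<open>x\<close> is tangent to \<open>\<Omega>\<close>: close to \<open>x\<close>, every
  cone strictly behind that hyperplane lies inside \<open>\<Omega>\<close>, every cone strictly in front of it outside.
\<close>

definition outward_normal :: "'a::euclidean_space set \<Rightarrow> 'a \<Rightarrow> 'a" where
  "outward_normal \<Omega> x = (THE \<nu>. norm \<nu> = 1 \<and>
     (\<forall>\<epsilon>>0. \<forall>\<^sub>F y in at x.
        ((y - x) \<bullet> \<nu> < - \<epsilon> * norm (y - x) \<longrightarrow> y \<in> \<Omega>) \<and>
        ((y - x) \<bullet> \<nu> > \<epsilon> * norm (y - x) \<longrightarrow> y \<notin> \<Omega>)))"


subsection \<open>Surface measure\<close>

text \<open>
  The surface measure \<open>dS\<close> is the \<open>(d - 1)\<close>-dimensional Hausdorff measure, normalised so that it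
  agrees with Lebesgue measure on flat pieces.  The covering sets are required to be bounded because
  \<^const>\<open>diameter\<close> is meaningless on unbounded sets.  By Caratheodory's criterion the outer
  measure is countably additive on Borel sets, so \<^const>\<open>measure_of\<close> does not fall back to the
  zero measure.
\<close>

definition hausdorff_outer :: "nat \<Rightarrow> 'a::metric_space set \<Rightarrow> ennreal" where
  "hausdorff_outer m A =
     (SUP \<delta>\<in>{0<..}. INF U\<in>{U :: nat \<Rightarrow> 'a set.
          A \<subseteq> (\<Union>i. U i) \<and> (\<forall>i. bounded (U i) \<and> diameter (U i) \<le> \<delta>)}.
        \<Sum>i. ennreal (unit_ball_vol (real m) * (diameter (U i) / 2) ^ m))"

definition hausdorff_measure :: "nat \<Rightarrow> 'a::metric_space measure" where
  "hausdorff_measure m = measure_of UNIV (sets borel) (hausdorff_outer m)"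

definition surface_measure :: "'a::euclidean_space set \<Rightarrow> 'a measure" where
  "surface_measure \<Omega> = restrict_space (hausdorff_measure (DIM('a) - 1)) (frontier \<Omega>)"


subsection \<open>Sobolev spaces of order \<open>\<plusminus>1/2\<close> on the boundary\<close>

text \<open>
  Elements of \<open>L\<^sup>2(\<partial>\<Omega>)\<close> and \<open>H\<^sup>1\<^sup>/\<^sup>2(\<partial>\<Omega>)\<close> are represented by functions; two functions represent
  the same element iff they agree almost everywhere for the surface measure.
\<close>

definition L2_bd :: "'a::euclidean_space set \<Rightarrow> ('a \<Rightarrow> real) set" where
  "L2_bd \<Omega> = {f \<in> borel_measurable (surface_measure \<Omega>).
     (\<integral>\<^sup>+x. ennreal ((f x)\<^sup>2) \<partial>surface_measure \<Omega>) < \<infinity>}"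

text \<open>
  The Sobolev-Slobodeckij norm of order \<open>s = 1/2\<close> on a \<open>(d - 1)\<close>-dimensional surface; the exponent
  is \<open>(d - 1) + 2 * s = d\<close>.
\<close>

definition H12_norm_sq :: "'a::euclidean_space set \<Rightarrow> ('a \<Rightarrow> real) \<Rightarrow> ennreal" where
  "H12_norm_sq \<Omega> f =
     (\<integral>\<^sup>+x. ennreal ((f x)\<^sup>2) \<partial>surface_measure \<Omega>) +
     (\<integral>\<^sup>+x. (\<integral>\<^sup>+y. ennreal ((f x - f y)\<^sup>2 / norm (x - y) ^ DIM('a))
        \<partial>surface_measure \<Omega>) \<partial>surface_measure \<Omega>)"

definition H12 :: "'a::euclidean_space set \<Rightarrow> ('a \<Rightarrow> real) set" where
  "H12 \<Omega> = {f \<in> borel_measurable (surface_measure \<Omega>). H12_norm_sq \<Omega> f < \<infinity>}"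

definition H12_norm :: "'a::euclidean_space set \<Rightarrow> ('a \<Rightarrow> real) \<Rightarrow> real" where
  "H12_norm \<Omega> f = sqrt (enn2real (H12_norm_sq \<Omega> f))"

text \<open>
  \<open>H\<^sup>-\<^sup>1\<^sup>/\<^sup>2(\<partial>\<Omega>)\<close> is the dual space of \<open>H\<^sup>1\<^sup>/\<^sup>2(\<partial>\<Omega>)\<close>; the pairing of \<open>\<phi>\<close> with \<open>f\<close> is the value
  \<open>\<phi> f\<close>.  Boundedness makes \<open>\<phi>\<close> insensitive to changes of \<open>f\<close> on null sets.  Functionals are set
  to zero outside \<^term>\<open>H12 \<Omega>\<close>, so that equality in the dual space is equality of functions.
\<close>

definition Hm12 :: "'a::euclidean_space set \<Rightarrow> (('a \<Rightarrow> real) \<Rightarrow> real) set" where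
  "Hm12 \<Omega> = {\<phi>.
     (\<forall>f\<in>H12 \<Omega>. \<forall>g\<in>H12 \<Omega>. \<forall>a b. \<phi> (\<lambda>x. a * f x + b * g x) = a * \<phi> f + b * \<phi> g) \<and>
     (\<exists>C. \<forall>f\<in>H12 \<Omega>. \<bar>\<phi> f\<bar> \<le> C * H12_norm \<Omega> f) \<and>
     (\<forall>f. f \<notin> H12 \<Omega> \<longrightarrow> \<phi> f = 0)}"

definition Hm12_norm :: "'a::euclidean_space set \<Rightarrow> (('a \<Rightarrow> real) \<Rightarrow> real) \<Rightarrow> real" where
  "Hm12_norm \<Omega> \<phi> = (SUP f\<in>{f \<in> H12 \<Omega>. H12_norm \<Omega> f \<le> 1}. \<bar>\<phi> f\<bar>)"

text \<open>The canonical embedding of \<open>L\<^sup>2(\<partial>\<Omega>)\<close> into \<open>H\<^sup>-\<^sup>1\<^sup>/\<^sup>2(\<partial>\<Omega>)\<close>.\<close>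

definition density_functional :: "'a::euclidean_space set \<Rightarrow> ('a \<Rightarrow> real) \<Rightarrow> (('a \<Rightarrow> real) \<Rightarrow> real)" where
  "density_functional \<Omega> \<psi> = (\<lambda>f. if f \<in> H12 \<Omega> then (\<integral>x. \<psi> x * f x \<partial>surface_measure \<Omega>) else 0)"


subsection \<open>Layer potentials\<close>

definition fundamental_solution :: "'a::euclidean_space \<Rightarrow> real" where
  "fundamental_solution x =
     (if DIM('a) = 2 then 1 / (2 * pi) * ln (norm x)
      else - 1 / (real DIM('a) * (real DIM('a) - 2) * unit_ball_vol (real DIM('a)))
             * norm x powr (2 - real DIM('a)))"

definition gradient :: "('a::real_inner \<Rightarrow> real) \<Rightarrow> 'a \<Rightarrow> 'a" where
  "gradient f x = (THE D. GDERIV f x :> D)"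

definition single_layer_integral ::
    "'a::euclidean_space set \<Rightarrow> ('a \<Rightarrow> real) \<Rightarrow> 'a \<Rightarrow> real" where
  "single_layer_integral \<Omega> \<psi> x =
     (\<integral>y. fundamental_solution (x - y) * \<psi> y \<partial>surface_measure \<Omega>)"

definition NP_integral ::
    "'a::euclidean_space set \<Rightarrow> ('a \<Rightarrow> real) \<Rightarrow> 'a \<Rightarrow> real" where
  "NP_integral \<Omega> \<psi> x =
     (\<integral>y. (outward_normal \<Omega> x \<bullet> gradient (\<lambda>w. fundamental_solution (w - y)) x) * \<psi> y
        \<partial>surface_measure \<Omega>)"

text \<open>
  On \<open>H\<^sup>-\<^sup>1\<^sup>/\<^sup>2(\<partial>\<Omega>)\<close> the integral formulas are understood by continuous extension from the dense
  subspace \<open>L\<^sup>2(\<partial>\<Omega>)\<close>.  The two predicates below say that an operator is this extension; it is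
  uniquely determined (for the single layer potential, up to the choice of representatives in
  \<open>H\<^sup>1\<^sup>/\<^sup>2(\<partial>\<Omega>)\<close>).
\<close>

definition is_single_layer_potential ::
    "'a::euclidean_space set \<Rightarrow> ((('a \<Rightarrow> real) \<Rightarrow> real) \<Rightarrow> ('a \<Rightarrow> real)) \<Rightarrow> bool" where
  "is_single_layer_potential \<Omega> S \<longleftrightarrow>
     (\<forall>\<phi>\<in>Hm12 \<Omega>. S \<phi> \<in> H12 \<Omega>) \<and>
     (\<forall>\<phi>\<in>Hm12 \<Omega>. \<forall>\<psi>\<in>Hm12 \<Omega>. \<forall>a b. AE x in surface_measure \<Omega>.
        S (\<lambda>f. a * \<phi> f + b * \<psi> f) x = a * S \<phi> x + b * S \<psi> x) \<and>
     (\<exists>C. \<forall>\<phi>\<in>Hm12 \<Omega>. H12_norm \<Omega> (S \<phi>) \<le> C * Hm12_norm \<Omega> \<phi>) \<and>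
     (\<forall>\<psi>\<in>L2_bd \<Omega>. AE x in surface_measure \<Omega>.
        S (density_functional \<Omega> \<psi>) x = single_layer_integral \<Omega> \<psi> x)"

definition is_NP_operator ::
    "'a::euclidean_space set \<Rightarrow> ((('a \<Rightarrow> real) \<Rightarrow> real) \<Rightarrow> (('a \<Rightarrow> real) \<Rightarrow> real)) \<Rightarrow> bool" where
  "is_NP_operator \<Omega> K \<longleftrightarrow>
     (\<forall>\<phi>\<in>Hm12 \<Omega>. K \<phi> \<in> Hm12 \<Omega>) \<and>
     (\<forall>\<phi>\<in>Hm12 \<Omega>. \<forall>\<psi>\<in>Hm12 \<Omega>. \<forall>a b.
        K (\<lambda>f. a * \<phi> f + b * \<psi> f) = (\<lambda>f. a * K \<phi> f + b * K \<psi> f)) \<and>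
     (\<exists>C. \<forall>\<phi>\<in>Hm12 \<Omega>. Hm12_norm \<Omega> (K \<phi>) \<le> C * Hm12_norm \<Omega> \<phi>) \<and>
     (\<forall>\<psi>\<in>L2_bd \<Omega>. K (density_functional \<Omega> \<psi>) = density_functional \<Omega> (NP_integral \<Omega> \<psi>))"

text \<open>
  Bijectivity onto \<open>H\<^sup>1\<^sup>/\<^sup>2(\<partial>\<Omega>)\<close> modulo null sets.  For the bounded operators at hand, the inverse is
  automatically bounded, by the open mapping theorem.
\<close>

definition invertible_Hm12_H12 ::
    "'a::euclidean_space set \<Rightarrow> ((('a \<Rightarrow> real) \<Rightarrow> real) \<Rightarrow> ('a \<Rightarrow> real)) \<Rightarrow> bool" where
  "invertible_Hm12_H12 \<Omega> S \<longleftrightarrow>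
     (\<forall>f\<in>H12 \<Omega>. \<exists>!\<phi>. \<phi> \<in> Hm12 \<Omega> \<and> (AE x in surface_measure \<Omega>. S \<phi> x = f x))"

text \<open>The inner product on \<open>H\<^sup>-\<^sup>1\<^sup>/\<^sup>2(\<partial>\<Omega>)\<close> induced by the single layer potential \<open>S\<close>.\<close>

definition np_inner ::
    "((('a \<Rightarrow> real) \<Rightarrow> real) \<Rightarrow> ('a \<Rightarrow> real)) \<Rightarrow>
     (('a \<Rightarrow> real) \<Rightarrow> real) \<Rightarrow> (('a \<Rightarrow> real) \<Rightarrow> real) \<Rightarrow> real" where
  "np_inner S \<phi> \<psi> = - \<phi> (S \<psi>)"

definition orthogonal_eigensystem ::
    "'a::euclidean_space set \<Rightarrow> ((('a \<Rightarrow> real) \<Rightarrow> real) \<Rightarrow> ('a \<Rightarrow> real)) \<Rightarrow>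
     ((('a \<Rightarrow> real) \<Rightarrow> real) \<Rightarrow> (('a \<Rightarrow> real) \<Rightarrow> real)) \<Rightarrow>
     (nat \<Rightarrow> (('a \<Rightarrow> real) \<Rightarrow> real)) \<Rightarrow> bool" where
  "orthogonal_eigensystem \<Omega> S K \<phi> \<longleftrightarrow>
     (\<forall>n\<ge>1. \<phi> n \<in> Hm12 \<Omega> \<and> \<phi> n \<noteq> (\<lambda>f. 0) \<and> (\<exists>\<mu>::real. K (\<phi> n) = (\<lambda>f. \<mu> * \<phi> n f))) \<and>
     (\<forall>m\<ge>1. \<forall>n\<ge>1. m \<noteq> n \<longrightarrow> np_inner S (\<phi> m) (\<phi> n) = 0)"

text \<open>
  If \<open>\<Omega>\<close> has holes, \<open>\<langle>q\<^sub>z, \<phi>\<rangle>\<close> can vanish for all \<open>z\<close> in a hole: for an annulus and a radial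
  eigenfunction \<open>\<phi>\<close>, the pairing is \<open>- v \<bullet> \<nabla>S[S[\<phi>]](z)\<close>, and \<open>S[S[\<phi>]]\<close> is constant in the hole.
  Statements about almost every exterior \<open>z\<close> therefore need the exterior of \<open>\<Omega>\<close> to be connected.
\<close>

definition dipole_source :: "'a::euclidean_space \<Rightarrow> 'a \<Rightarrow> 'a \<Rightarrow> real" where
  "dipole_source v z x = v \<bullet> gradient (\<lambda>w. fundamental_solution (w - x)) z"

end

theory Submission
  imports Defs "HOL-Complex_Analysis.Complex_Analysis"
begin

text \<open>
  Put \<open>\<psi> = S \<phi>\<^sub>n\<close>.  For exterior \<open>z\<close> the pairing is, up to sign, \<open>F z = v \<bullet> \<nabla>u z\<close>, where
  \<open>u\<close> is the single layer potential with density \<open>\<psi>\<close>.  Along every line both functions extend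
  holomorphically to a complex neighbourhood, so by Fubini for dilations a non-null zero set of
  \<open>F\<close> in the connected exterior forces \<open>F = 0\<close> there.  Then \<open>u\<close> is constant on rays in
  direction \<open>v\<close>, and its behaviour at infinity gives \<open>u = 0\<close> on a half space, hence in the exterior.
  Nontangential limits give \<open>u = 0\<close> on \<open>\<partial>\<Omega>\<close>, i.e. \<open>S \<psi> = 0\<close>, and applying injectivity of \<open>S\<close>
  twice, first to \<open>\<psi>\<close> and then to \<open>\<phi>\<^sub>n\<close>, contradicts \<open>\<phi>\<^sub>n \<noteq> 0\<close>.
\<close>

subsection \<open>Holomorphic dependence of integrals on a parameter\<close>

text \<open>Working along complex lines avoids analyticity in several variables, but zeros must then
  be propagated by measure. If H c is non-zero, each line through c carries only countably many
  zeros nearby, so the zero set is null in a convex neighbourhood of c. This fits the hypothesis of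
  the contradiction, which supplies a non-negligible zero set and no open one. In dimension two the
  potential grows like m / (2 pi) times log |x|, where m is the integral of the density. Constancy
  along a ray has to force m = 0 first; only then does the potential tend to 0. The operator S acts
  on functionals and is a concrete integral on L2 densities only. The function \<psi> is such a
  density because it lies in H^(1/2), so S can be applied to it a second time, now as an integral.
  The C^(1,alpha) charts enter as Lipschitz graphs: they bound the surface measure and give |x - y|
  <= C |z - y| for boundary points y when z approaches x from outside.\<close>

lemma has_field_derivative_integral_holomorphic:
  fixes g :: "'b \<Rightarrow> complex \<Rightarrow> complex"
  assumes U: "open U" "s0 \<in> U"
    and hol: "\<And>y. y \<in> space M \<Longrightarrow> g y holomorphic_on U"
    and meas: "\<And>s. s \<in> U \<Longrightarrow> (\<lambda>y. g y s) \<in> borel_measurable M"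
    and b: "integrable M b"
    and bound: "\<And>y s. y \<in> space M \<Longrightarrow> s \<in> U \<Longrightarrow> norm (g y s) \<le> b y"
  shows "((\<lambda>s. \<integral>y. g y s \<partial>M) has_field_derivative (\<integral>y. deriv (g y) s0 \<partial>M)) (at s0)"
proof -
  \<comment> \<open>Twice the radius is reserved so that discs of radius \<open>r\<close> about all
    points of \<open>cball s0 r\<close> stay inside \<open>U\<close>.\<close>
  obtain r where r: "r > 0" and cb: "cball s0 (2 * r) \<subseteq> U"
  proof -
    obtain e where "e > 0" "cball s0 e \<subseteq> U"
      using U open_contains_cball by blast
    then show thesis by (intro that[of "e / 2"]) auto
  qed
  have sub: "cball s r \<subseteq> U" if "s \<in> cball s0 r" for s
  proof
    fix w assume "w \<in> cball s r"
    then have "dist s0 w \<le> 2 * r"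
      using that dist_triangle[of s0 w s] by auto
    then show "w \<in> U" using cb by auto
  qed
  have der: "(g y has_field_derivative deriv (g y) s) (at s)" if "y \<in> space M" "s \<in> U" for y s
    using hol[OF that(1)] U(1) that(2) holomorphic_derivI by blast
  \<comment> \<open>Cauchy's estimate turns the bound on \<open>g\<close> into one on its
    derivative, so \<open>b / r\<close> will dominate the difference quotients.\<close>
  have dbound: "norm (deriv (g y) s) \<le> b y / r" if "y \<in> space M" "s \<in> cball s0 r" for y s
  proof -
    have "norm ((deriv ^^ 1) (g y) s) \<le> fact 1 * b y / r ^ 1"
    proof (rule Cauchy_inequality)
      show "g y holomorphic_on ball s r"
        using hol[OF that(1)] sub[OF that(2)] ball_subset_cball holomorphic_on_subset by blast
      show "continuous_on (cball s r) (g y)"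
        using hol[OF that(1)] sub[OF that(2)] holomorphic_on_imp_continuous_on continuous_on_subset by blast
      show "norm (g y x) \<le> b y" if "norm (s - x) = r" for x
        using bound[OF \<open>y \<in> space M\<close>] sub[OF \<open>s \<in> _\<close>] that by (auto simp: dist_norm subset_iff)
    qed (use r in auto)
    then show ?thesis by simp
  qed
  have quot: "norm (g y s - g y s0) \<le> b y / r * norm (s - s0)"
    if "y \<in> space M" "s \<in> cball s0 r" for y s
  proof (rule field_differentiable_bound[of "cball s0 r"])
    show "(g y has_field_derivative deriv (g y) z) (at z within cball s0 r)"
      if "z \<in> cball s0 r" for z
      using der[OF \<open>y \<in> space M\<close>] sub[OF that] r that
      by (meson DERIV_subset centre_in_cball less_imp_le subsetD subset_UNIV)
  qed (use that dbound r in auto)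
  have meas_int: "(\<lambda>y. g y s) \<in> borel_measurable M" "integrable M (\<lambda>y. g y s)" if "s \<in> U" for s
    using meas[OF that] bound that by (auto intro!: Bochner_Integration.integrable_bound[OF b] AE_I2 order_trans[OF bound abs_ge_self])
  have lim: "(\<lambda>n. \<integral>y. (g y (X n) - g y s0) / (X n - s0) \<partial>M) \<longlonglongrightarrow> (\<integral>y. deriv (g y) s0 \<partial>M)"
    if X: "\<And>n. X n \<in> cball s0 r - {s0}" "X \<longlonglongrightarrow> s0" for X
  proof -
    have XU: "X n \<in> U" for n using X(1) sub r by (meson DiffD1 centre_in_cball less_imp_le subsetD)
    have conv: "(\<lambda>n. (g y (X n) - g y s0) / (X n - s0)) \<longlonglongrightarrow> deriv (g y) s0" if "y \<in> space M" for y
    proof -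
      have "((\<lambda>s. (g y s - g y s0) / (s - s0)) \<longlongrightarrow> deriv (g y) s0) (at s0)"
        using der[OF that U(2)] by (simp add: has_field_derivative_iff)
      then show ?thesis using X unfolding tendsto_at_iff_sequentially comp_def by auto
    qed
    have m: "(\<lambda>y. (g y (X n) - g y s0) / (X n - s0)) \<in> borel_measurable M" for n
      using meas_int(1)[OF XU] meas_int(1)[OF U(2)] by measurable
    show ?thesis
    proof (rule integral_dominated_convergence)
      \<comment> \<open>Measurability in \<open>y\<close> comes from writing the derivative as a
        pointwise limit of measurable difference quotients.\<close>
      show "(\<lambda>y. deriv (g y) s0) \<in> borel_measurable M"
        by (rule borel_measurable_LIMSEQ_metric[OF m conv])
      show "integrable M (\<lambda>y. b y / r)" using b by simp
      show "AE y in M. (\<lambda>n. (g y (X n) - g y s0) / (X n - s0)) \<longlonglongrightarrow> deriv (g y) s0"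
        using conv by auto
      show "AE y in M. norm ((g y (X n) - g y s0) / (X n - s0)) \<le> b y / r" for n
      proof (rule AE_I2)
        fix y assume "y \<in> space M"
        moreover have "X n \<in> cball s0 r" "X n \<noteq> s0" using X(1)[of n] by auto
        ultimately show "norm ((g y (X n) - g y s0) / (X n - s0)) \<le> b y / r"
          using quot[of y "X n"] by (simp add: norm_divide pos_divide_le_eq)
      qed
    qed (rule m)
  qed
  have "((\<lambda>s. ((\<integral>y. g y s \<partial>M) - (\<integral>y. g y s0 \<partial>M)) / (s - s0)) \<longlongrightarrow> (\<integral>y. deriv (g y) s0 \<partial>M))
      (at s0 within cball s0 r)"
    unfolding tendsto_at_iff_sequentially comp_def
  proof (intro allI impI)
    fix X assume X: "\<forall>i. X i \<in> cball s0 r - {s0}" "X \<longlonglongrightarrow> s0"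
    have XU: "X n \<in> U" for n using X(1) sub r by (meson DiffD1 centre_in_cball less_imp_le subsetD)
    have "(\<integral>y. (g y (X n) - g y s0) / (X n - s0) \<partial>M) = ((\<integral>y. g y (X n) \<partial>M) - (\<integral>y. g y s0 \<partial>M)) / (X n - s0)" for n
      using meas_int(2)[OF XU] meas_int(2)[OF U(2)] by simp
    then show "(\<lambda>n. ((\<integral>y. g y (X n) \<partial>M) - (\<integral>y. g y s0 \<partial>M)) / (X n - s0)) \<longlonglongrightarrow> (\<integral>y. deriv (g y) s0 \<partial>M)"
      using lim[of X] X by simp
  qed
  moreover have "at s0 within cball s0 r = at s0"
    using r by (intro at_within_interior) simp
  ultimately show ?thesis by (simp add: has_field_derivative_iff)
qed

subsection \<open>Functions that are analytic along lines\<close>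

text \<open>A one-variable substitute for real analyticity. The radius may depend on both the point
  and the direction, so each line can be treated by itself.\<close>

definition line_analytic_on :: "('a::euclidean_space \<Rightarrow> real) \<Rightarrow> 'a set \<Rightarrow> bool" where
  "line_analytic_on H W \<longleftrightarrow> (\<forall>c\<in>W. \<forall>h. \<exists>\<delta>>0. \<exists>f. f holomorphic_on ball 0 \<delta> \<and>
     (\<forall>s::real. \<bar>s\<bar> < \<delta> \<longrightarrow> f (of_real s) = of_real (H (c + s *\<^sub>R h))))"

text \<open>A holomorphic function on a disc vanishes identically or has isolated zeros. The filter
  \<open>at\<close> in the second case leaves the value at \<open>s0\<close> itself open.\<close>

lemma line_analytic_on_dichotomy:
  fixes s0 :: real
  assumes "line_analytic_on H W" "c + s0 *\<^sub>R h \<in> W"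
  shows "(\<forall>\<^sub>F s in nhds s0. H (c + s *\<^sub>R h) = 0) \<or> (\<forall>\<^sub>F s in at s0. H (c + s *\<^sub>R h) \<noteq> 0)"
proof -
  obtain \<delta> f where \<delta>: "\<delta> > 0" and f: "f holomorphic_on ball 0 \<delta>"
    and ext: "\<And>s::real. \<bar>s\<bar> < \<delta> \<Longrightarrow> f (of_real s) = of_real (H ((c + s0 *\<^sub>R h) + s *\<^sub>R h))"
    using assms unfolding line_analytic_on_def by blast
  have ext': "f (of_real (s - s0)) = of_real (H (c + s *\<^sub>R h))" if "dist s s0 < \<delta>" for s
    using ext[of "s - s0"] that by (simp add: dist_real_def algebra_simps)
  show ?thesis
  proof (cases "\<exists>\<beta>\<in>ball 0 \<delta>. f \<beta> \<noteq> 0")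
    case False
    then have "H (c + s *\<^sub>R h) = 0" if "dist s s0 < \<delta>" for s
      using ext'[OF that] that by (auto simp: dist_real_def simp flip: of_real_diff)
    then show ?thesis using \<delta> by (auto simp: eventually_nhds_metric)
  next
    case True
    then obtain \<beta> where \<beta>: "\<beta> \<in> ball 0 \<delta>" "f \<beta> \<noteq> 0" by blast
    have "\<exists>r>0. \<forall>w\<in>ball 0 r - {0}. f w \<noteq> 0"
    proof (cases "f 0 = 0")
      case True
      then show ?thesis
        using isolated_zeros[OF f open_ball connected_ball _ _ \<beta>, of 0] \<delta> by (metis centre_in_ball)
    next
      case False
      have "isCont f 0"
        using f \<delta> holomorphic_on_imp_continuous_on continuous_on_eq_continuous_at[of "ball 0 \<delta>" f] by auto
      then have "\<forall>\<^sub>F w in nhds 0. f w \<noteq> 0"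
        using False by (simp add: isCont_def eventually_nhds_conv_at tendsto_imp_eventually_ne)
      then show ?thesis by (auto simp: eventually_nhds_metric dist_commute)
    qed
    then obtain r where r: "r > 0" "\<And>w. w \<in> ball 0 r - {0} \<Longrightarrow> f w \<noteq> 0" by blast
    have "H (c + s *\<^sub>R h) \<noteq> 0" if "s \<noteq> s0" "dist s s0 < min r \<delta>" for s
      using r(2)[of "of_real (s - s0)"] ext'[of s] that
      by (auto simp: dist_real_def simp flip: of_real_diff)
    then show ?thesis using r(1) \<delta> unfolding eventually_at by (metis min_less_iff_conj)
  qed
qed

text \<open>Convexity of \<open>B\<close> makes the parameter set \<open>A\<close> an interval. By
  the dichotomy, the parameters near which H vanishes form a clopen subset of it, which misses 0;
  hence all zeros are isolated and therefore countable.\<close>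

lemma line_analytic_on_countable_zeros:
  assumes H: "line_analytic_on H W" and B: "convex B" "open B" "B \<subseteq> W" "c \<in> B" "H c \<noteq> 0"
  shows "countable {s::real. c + s *\<^sub>R h \<in> B \<and> H (c + s *\<^sub>R h) = 0}"
proof -
  define A where "A = (\<lambda>s::real. c + s *\<^sub>R h) -` B"
  have openA: "open A"
    unfolding A_def by (intro open_vimage B continuous_intros)
  have "convex A"
    unfolding convex_def
  proof (intro ballI allI impI)
    fix x y u v :: real assume *: "x \<in> A" "y \<in> A" "0 \<le> u" "0 \<le> v" "u + v = 1"
    have "c = (u + v) *\<^sub>R c" using * by simp
    then have "c + (u *\<^sub>R x + v *\<^sub>R y) *\<^sub>R h = u *\<^sub>R (c + x *\<^sub>R h) + v *\<^sub>R (c + y *\<^sub>R h)"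
      by (simp add: algebra_simps)
    then show "u *\<^sub>R x + v *\<^sub>R y \<in> A"
      using * B(1) by (auto simp: A_def convex_def)
  qed
  define E where "E = {s \<in> A. \<forall>\<^sub>F t in nhds s. H (c + t *\<^sub>R h) = 0}"
  have opE: "open E"
  proof (subst open_subopen, rule ballI)
    fix s assume "s \<in> E"
    then obtain T where "open T" "s \<in> T" "\<And>t. t \<in> T \<Longrightarrow> H (c + t *\<^sub>R h) = 0"
      unfolding E_def eventually_nhds by blast
    then have "T \<inter> A \<subseteq> E" unfolding E_def eventually_nhds by blast
    then show "\<exists>T. open T \<and> s \<in> T \<and> T \<subseteq> E"
      using \<open>open T\<close> openA \<open>s \<in> T\<close> \<open>s \<in> E\<close> by (intro exI[of _ "T \<inter> A"]) (auto simp: E_def)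
  qed
  have iso: "\<forall>\<^sub>F t in at s. H (c + t *\<^sub>R h) \<noteq> 0" if "s \<in> A - E" for s
    using line_analytic_on_dichotomy[OF H, of c s h] that B(3) unfolding A_def E_def by auto
  have opAE: "open (A - E)"
  proof (subst open_subopen, rule ballI)
    fix s assume s: "s \<in> A - E"
    then obtain T where T: "open T" "s \<in> T" "\<And>t. t \<in> T \<Longrightarrow> t \<noteq> s \<Longrightarrow> H (c + t *\<^sub>R h) \<noteq> 0"
      using iso[OF s] unfolding eventually_at_topological by blast
    have "t \<notin> E" if "t \<in> T" for t
    proof (cases "t = s")
      case False
      then show ?thesis using T(3)[OF that] eventually_nhds_x_imp_x unfolding E_def by blast
    qed (use s in auto)
    then show "\<exists>T. open T \<and> s \<in> T \<and> T \<subseteq> A - E"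
      using T openA s by (intro exI[of _ "T \<inter> A"]) auto
  qed
  have "0 \<in> A - E"
    using B(4,5) eventually_nhds_x_imp_x unfolding A_def E_def by fastforce
  moreover have "connected A" using \<open>convex A\<close> convex_connected by blast
  ultimately have "E = {}"
    using opE opAE unfolding connected_def E_def by blast
  then have "{s. H (c + s *\<^sub>R h) = 0} sparse_in A"
    using iso by (simp add: sparse_in_eventually_iff[OF openA])
  then have "countable (A \<inter> {s. H (c + s *\<^sub>R h) = 0})"
    by (rule sparse_imp_countable[OF openA])
  then show ?thesis by (auto simp: A_def Int_def)
qed

text \<open>Fubini for the dilations about \<open>c\<close>: almost every dilate of \<open>Z\<close> is null, hence so is \<open>Z\<close>.\<close>
lemma negligible_if_countable_on_lines:
  fixes c :: "'a::euclidean_space"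
  assumes Z: "Z \<in> sets borel" and c: "\<And>h. countable {s::real. c + s *\<^sub>R h \<in> Z}"
  shows "negligible Z"
proof -
  have [measurable]: "Z \<in> sets borel" by (rule Z)
  have "AE s in lborel. c + s *\<^sub>R h \<notin> Z" for h
    using AE_not_in[OF countable_imp_null_set_lborel[OF c]] by simp
  then have "AE h in lborel. AE s in lborel. c + s *\<^sub>R h \<notin> Z" by simp
  \<comment> \<open>Swapping the two almost-everywhere quantifiers is where \<open>Z\<close> has to
    be Borel.\<close>
  then have "AE s in lborel. AE h in lborel. c + s *\<^sub>R h \<notin> Z"
    by (subst lborel_pair.AE_commute) measurable
  then have "AE s in lborel. s \<noteq> 0 \<and> (AE h in lborel. c + s *\<^sub>R h \<notin> Z)"
    using AE_lborel_singleton[of 0] by eventually_elim auto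
  \<comment> \<open>A property that holds almost everywhere on the real line holds somewhere; one
    dilation factor \<open>s \<noteq> 0\<close> is enough.\<close>
  moreover have "ae_filter (lborel :: real measure) \<noteq> bot"
    by (simp add: ae_filter_eq_bot_iff)
  ultimately obtain s where s: "s \<noteq> 0" "AE h in lborel. c + s *\<^sub>R h \<notin> Z"
    using eventually_happens' by blast
  have "{h \<in> space lborel. c + s *\<^sub>R h \<in> Z} \<in> sets lborel" by measurable
  then have "{h. c + s *\<^sub>R h \<in> Z} \<in> null_sets lborel"
    using s(2) by (simp add: AE_iff_null_sets)
  then have "negligible {h. c + s *\<^sub>R h \<in> Z}"
    by (simp add: negligible_iff_null_sets null_sets_completionI)
  then have "negligible ((\<lambda>h. c + s *\<^sub>R h) ` {h. c + s *\<^sub>R h \<in> Z})"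
    by (intro negligible_differentiable_image_negligible) (auto intro!: derivative_intros)
  moreover have "Z \<subseteq> (\<lambda>h. c + s *\<^sub>R h) ` {h. c + s *\<^sub>R h \<in> Z}"
  proof
    fix z assume "z \<in> Z"
    then have "z = c + s *\<^sub>R ((1 / s) *\<^sub>R (z - c))" using s(1) by simp
    with \<open>z \<in> Z\<close> show "z \<in> (\<lambda>h. c + s *\<^sub>R h) ` {h. c + s *\<^sub>R h \<in> Z}" by (metis imageI mem_Collect_eq)
  qed
  ultimately show ?thesis by (rule negligible_subset)
qed

text \<open>The set \<open>T\<close> of points near which H vanishes is clopen in \<open>W\<close>
  and non-empty. Both closedness and non-emptiness come from \<open>ballT\<close>: a ball with a
  non-null zero set has its centre in \<open>T\<close>. If \<open>T\<close> were empty, the zero set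
  would be locally null, hence null.\<close>

proposition line_analytic_on_identity:
  fixes H :: "'a::euclidean_space \<Rightarrow> real"
  assumes H: "line_analytic_on H W" "H \<in> borel_measurable borel"
    and W: "open W" "connected W"
    and nz: "\<not> negligible {z \<in> W. H z = 0}"
    and z: "z \<in> W"
  shows "H z = 0"
proof -
  have [measurable]: "H \<in> borel_measurable borel" by (rule H)
  have local: "H c = 0" if B: "convex B" "open B" "B \<subseteq> W" "\<not> negligible {z \<in> B. H z = 0}" "c \<in> B" for B c
  proof (rule ccontr)
    assume "H c \<noteq> 0"
    have [measurable]: "B \<in> sets borel" using B by simp
    have "countable {s::real. c + s *\<^sub>R h \<in> {z \<in> B. H z = 0}}" for h
      using line_analytic_on_countable_zeros[OF H(1) B(1-3,5) \<open>H c \<noteq> 0\<close>] by simp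
    then have "negligible {z \<in> B. H z = 0}"
      by (rule negligible_if_countable_on_lines[rotated]) measurable
    with B show False by blast
  qed
  define T where "T = {z \<in> W. \<forall>\<^sub>F w in nhds z. H w = 0}"
  have opT: "open T"
  proof (subst open_subopen, rule ballI)
    fix z assume "z \<in> T"
    then obtain U where "open U" "z \<in> U" "\<And>t. t \<in> U \<Longrightarrow> H t = 0"
      unfolding T_def eventually_nhds by blast
    then have "U \<inter> W \<subseteq> T" unfolding T_def eventually_nhds by blast
    then show "\<exists>U. open U \<and> z \<in> U \<and> U \<subseteq> T"
      using \<open>open U\<close> W(1) \<open>z \<in> U\<close> \<open>z \<in> T\<close> by (intro exI[of _ "U \<inter> W"]) (auto simp: T_def)
  qed
  have ballT: "z \<in> T" if "ball z r \<subseteq> W" "r > 0" "\<not> negligible {w \<in> ball z r. H w = 0}" for z r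
  proof -
    have "\<forall>\<^sub>F w in nhds z. w \<in> ball z r" using that by (intro eventually_nhds_in_open) auto
    then have "\<forall>\<^sub>F w in nhds z. H w = 0"
      using local[OF convex_ball open_ball that(1,3)] by (rule eventually_mono)
    then show ?thesis using that by (auto simp: T_def)
  qed
  have "open (W - T)"
  proof (subst open_subopen, rule ballI)
    fix z assume z: "z \<in> W - T"
    then obtain r where r: "r > 0" "ball z r \<subseteq> W"
      using W(1) open_contains_ball by blast
    \<comment> \<open>If the ball met the open set \<open>T\<close>, it would contain an open set of
      zeros, which is non-null, and its centre would lie in \<open>T\<close>.\<close>
    have "ball z r \<inter> T = {}"
    proof (rule ccontr)
      assume "ball z r \<inter> T \<noteq> {}"
      moreover have "ball z r \<inter> T \<subseteq> {w \<in> ball z r. H w = 0}"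
        using eventually_nhds_x_imp_x unfolding T_def by blast
      ultimately have "\<not> negligible {w \<in> ball z r. H w = 0}"
        using opT open_not_negligible[of "ball z r \<inter> T"] negligible_subset by blast
      then show False using ballT[OF r(2,1)] z by blast
    qed
    then show "\<exists>U. open U \<and> z \<in> U \<and> U \<subseteq> W - T"
      using r by (intro exI[of _ "ball z r"]) auto
  qed
  moreover have "T \<noteq> {}"
  proof
    assume "T = {}"
    have "negligible {z \<in> W. H z = 0}"
    proof (subst locally_negligible_alt, rule ballI)
      fix z assume z: "z \<in> {z \<in> W. H z = 0}"
      then obtain r where r: "r > 0" "ball z r \<subseteq> W"
        using W(1) open_contains_ball by blast
      then have "negligible {w \<in> ball z r. H w = 0}" using ballT \<open>T = {}\<close> by blast
      moreover have "{z \<in> W. H z = 0} \<inter> ball z r \<subseteq> {w \<in> ball z r. H w = 0}" by auto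
      ultimately have "negligible ({z \<in> W. H z = 0} \<inter> ball z r)" by (rule negligible_subset)
      then show "\<exists>U. openin (top_of_set {z \<in> W. H z = 0}) U \<and> z \<in> U \<and> negligible U"
        using z r by (intro exI[of _ "{z \<in> W. H z = 0} \<inter> ball z r"]) auto
    qed
    with nz show False by blast
  qed
  ultimately have "W \<subseteq> T"
    using opT W(2) unfolding connected_def T_def by blast
  then show ?thesis using z eventually_nhds_x_imp_x unfolding T_def by blast
qed

subsection \<open>Potentials along lines\<close>

text \<open>
  \<open>kc x h\<close> is a holomorphic extension of \<open>s \<mapsto> k (x + s h)\<close>; the disc \<open>2 |s| |h| < |x|\<close> is small
  enough to keep the extension of \<open>|x + s h|\<^sup>2\<close> in the right half plane.
\<close>
definition line_kernel :: "('a::euclidean_space \<Rightarrow> real) \<Rightarrow> ('a \<Rightarrow> 'a \<Rightarrow> complex \<Rightarrow> complex) \<Rightarrow> bool" where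
  "line_kernel k kc \<longleftrightarrow>
     (\<forall>x h. kc x h holomorphic_on {s. 2 * norm s * norm h < norm x}) \<and>
     (\<forall>h. continuous_on {p. 2 * norm (snd p) * norm h < norm (fst p)} (\<lambda>p. kc (fst p) h (snd p))) \<and>
     (\<forall>x h s. 2 * \<bar>s\<bar> * norm h < norm x \<longrightarrow> kc x h (of_real s) = of_real (k (x + s *\<^sub>R h)))"

text \<open>The \<open>+ 1\<close> keeps the quotient meaningful for \<open>h = 0\<close> and leaves
  the surplus \<open>2 * norm s\<close> that makes the inequality strict.\<close>

lemma less_of_norm_le_divide:
  fixes s :: "'b::real_normed_vector" and h :: "'a::real_normed_vector"
  assumes "0 < d" "norm s \<le> d / (2 * (norm h + 1))"
  shows "2 * norm s * norm h < d"
proof -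
  have pos: "0 < 2 * (norm h + 1)" by (simp add: add_nonneg_pos)
  have "norm s * (2 * (norm h + 1)) \<le> d"
    using assms(2) unfolding pos_le_divide_eq[OF pos] .
  then have "2 * norm s * norm h + 2 * norm s \<le> d" by (simp add: algebra_simps)
  then show ?thesis using assms(1) zero_less_norm_iff[of s] by (cases "s = 0") (simp, linarith)
qed

text \<open>The positive distance from \<open>z\<close> to the compact set \<open>F\<close> gives
  one disc that serves every \<open>y\<close> in \<open>F\<close>. Joint continuity of the extension
  bounds it on the compact set \<open>K\<close>, so a multiple of |\<psi>| dominates the
  integrands.\<close>

lemma line_kernel_potential:
  fixes M :: "'a::euclidean_space measure"
  assumes k: "line_kernel k kc"
    and F: "compact F" "sets M = sets (restrict_space borel F)"
    and \<psi>: "integrable M \<psi>" and z: "z \<notin> F"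
  obtains \<delta> f where "\<delta> > 0" "f holomorphic_on ball 0 \<delta>"
    "\<And>s::real. \<bar>s\<bar> < \<delta> \<Longrightarrow> f (of_real s) = of_real (\<integral>y. k (z + s *\<^sub>R h - y) * \<psi> y \<partial>M)"
    "(f has_field_derivative (\<integral>y. deriv (kc (z - y) h) 0 * of_real (\<psi> y) \<partial>M)) (at 0)"
proof -
  have space: "space M = F"
    using sets_eq_imp_space_eq[OF F(2)] by (simp add: space_restrict_space)
  have hol: "kc x h holomorphic_on {s. 2 * norm s * norm h < norm x}"
    and cont: "continuous_on {p. 2 * norm (snd p) * norm h < norm (fst p)} (\<lambda>p. kc (fst p) h (snd p))"
    and ext: "2 * \<bar>s\<bar> * norm h < norm x \<Longrightarrow> kc x h (of_real s) = of_real (k (x + s *\<^sub>R h))" for x h s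
    using k unfolding line_kernel_def by blast+
  obtain d where d: "d > 0" "\<And>y. y \<in> F \<Longrightarrow> d \<le> dist z y"
    using separate_point_closed[OF compact_imp_closed[OF F(1)] z] by blast
  define \<delta> where "\<delta> = d / (2 * (norm h + 1))"
  have \<delta>: "\<delta> > 0" using d by (simp add: \<delta>_def add_nonneg_pos)
  have small: "2 * norm s * norm h < norm (z - y)" if "y \<in> F" "norm s \<le> \<delta>" for y and s :: complex
    using less_of_norm_le_divide[OF d(1) that(2)[unfolded \<delta>_def]] d(2)[OF that(1)]
    by (simp add: dist_norm)
  define K where "K = (\<lambda>y. z - y) ` F \<times> cball (0::complex) \<delta>"
  have "compact K"
    unfolding K_def by (intro compact_Times compact_continuous_image F continuous_intros compact_cball)
  moreover have "K \<subseteq> {p. 2 * norm (snd p) * norm h < norm (fst p)}"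
    using small by (auto simp: K_def)
  ultimately have "compact ((\<lambda>p. kc (fst p) h (snd p)) ` K)"
    using cont compact_continuous_image continuous_on_subset by blast
  then obtain B where B: "\<And>p. p \<in> K \<Longrightarrow> norm (kc (fst p) h (snd p)) \<le> B"
    by (meson bounded_iff compact_imp_bounded imageI)
  define g where "g = (\<lambda>y s. kc (z - y) h s * of_real (\<psi> y))"
  have ghol: "g y holomorphic_on ball 0 \<delta>" if "y \<in> space M" for y
    unfolding g_def
    using small that space by (intro holomorphic_intros holomorphic_on_subset[OF hol]) auto
  have gmeas: "(\<lambda>y. g y s) \<in> borel_measurable M" if "s \<in> ball 0 \<delta>" for s
  proof -
    have "continuous_on F (\<lambda>y. kc (fst (z - y, s)) h (snd (z - y, s)))"
      by (rule continuous_on_compose2[OF cont]) (use small that in \<open>auto intro!: continuous_intros\<close>)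
    then have "(\<lambda>y. kc (z - y) h s) \<in> borel_measurable M"
      using borel_measurable_continuous_on_restrict by (subst measurable_cong_sets[OF F(2) refl]) simp
    then show ?thesis using \<psi> unfolding g_def by measurable
  qed
  have gbound: "norm (g y s) \<le> B * norm (\<psi> y)" if "y \<in> space M" "s \<in> ball 0 \<delta>" for y s
    using B[of "(z - y, s)"] that space unfolding g_def K_def
    by (auto simp: norm_mult intro!: mult_right_mono)
  have der: "((\<lambda>s. \<integral>y. g y s \<partial>M) has_field_derivative (\<integral>y. deriv (g y) s0 \<partial>M)) (at s0)"
    if "s0 \<in> ball 0 \<delta>" for s0
    using \<psi> by (intro has_field_derivative_integral_holomorphic[OF open_ball that ghol gmeas _ gbound]) auto
  show thesis
  proof (rule that[OF \<delta>])
    show "(\<lambda>s. \<integral>y. g y s \<partial>M) holomorphic_on ball 0 \<delta>"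
      using der by (subst holomorphic_on_open[OF open_ball]) blast
    show "(\<integral>y. g y (of_real s) \<partial>M) = of_real (\<integral>y. k (z + s *\<^sub>R h - y) * \<psi> y \<partial>M)" if "\<bar>s\<bar> < \<delta>" for s
    proof -
      have "g y (of_real s) = of_real (k (z + s *\<^sub>R h - y) * \<psi> y)" if "y \<in> space M" for y
        using ext[of s h "z - y"] small[of y "of_real s"] that \<open>\<bar>s\<bar> < \<delta>\<close> space
        by (simp add: g_def algebra_simps)
      then have "(\<integral>y. g y (of_real s) \<partial>M) = (\<integral>y. complex_of_real (k (z + s *\<^sub>R h - y) * \<psi> y) \<partial>M)"
        by (intro Bochner_Integration.integral_cong) auto
      then show ?thesis by (simp only: integral_complex_of_real)
    qed
    have "deriv (g y) 0 = deriv (kc (z - y) h) 0 * of_real (\<psi> y)" if "y \<in> space M" for y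
    proof -
      have "(kc (z - y) h has_field_derivative deriv (kc (z - y) h) 0) (at 0)"
      proof (rule holomorphic_derivI[of _ "ball 0 \<delta>"])
        show "kc (z - y) h holomorphic_on ball 0 \<delta>"
          using small that space by (intro holomorphic_on_subset[OF hol]) auto
      qed (use \<delta> in auto)
      then show ?thesis
        unfolding g_def by (intro DERIV_imp_deriv) (auto intro!: derivative_eq_intros)
    qed
    then have "(\<integral>y. deriv (g y) 0 \<partial>M) = (\<integral>y. deriv (kc (z - y) h) 0 * of_real (\<psi> y) \<partial>M)"
      by (intro Bochner_Integration.integral_cong) auto
    then show "((\<lambda>s. \<integral>y. g y s \<partial>M) has_field_derivative
        (\<integral>y. deriv (kc (z - y) h) 0 * of_real (\<psi> y) \<partial>M)) (at 0)"
      using der[of 0] \<delta> by simp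
  qed
qed

lemma line_analytic_on_potential:
  fixes M :: "'a::euclidean_space measure"
  assumes "line_kernel k kc" "compact F" "sets M = sets (restrict_space borel F)" "integrable M \<psi>" "W \<inter> F = {}"
  shows "line_analytic_on (\<lambda>z. \<integral>y. k (z - y) * \<psi> y \<partial>M) W"
  unfolding line_analytic_on_def
proof (intro ballI allI)
  fix c h assume "c \<in> W"
  then have "c \<notin> F" using assms by blast
  from line_kernel_potential[OF assms(1-4) this, where h = h]
  obtain \<delta> f where "\<delta> > 0" "f holomorphic_on ball 0 \<delta>"
    "\<And>s::real. \<bar>s\<bar> < \<delta> \<Longrightarrow> f (of_real s) = of_real (\<integral>y. k (c + s *\<^sub>R h - y) * \<psi> y \<partial>M)"
    by metis
  then show "\<exists>\<delta>>0. \<exists>f. f holomorphic_on ball 0 \<delta> \<and>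
      (\<forall>s::real. \<bar>s\<bar> < \<delta> \<longrightarrow> f (of_real s) = of_real (\<integral>y. k (c + s *\<^sub>R h - y) * \<psi> y \<partial>M))"
    by blast
qed

text \<open>Supplies the Borel zero sets for the Fubini argument. It covers all \<open>z\<close>,
  also those in \<open>F\<close>, where a divergent integral has the value 0.\<close>

lemma borel_measurable_potential:
  fixes M :: "'a::euclidean_space measure" and k \<psi> :: "'a \<Rightarrow> real"
  assumes "finite_measure M" "sets M = sets (restrict_space borel F)"
    and [measurable]: "k \<in> borel_measurable borel" "\<psi> \<in> borel_measurable M"
  shows "(\<lambda>z. \<integral>y. k (z - y) * \<psi> y \<partial>M) \<in> borel_measurable borel"
proof -
  interpret finite_measure M by fact
  have [measurable]: "(\<lambda>y. y) \<in> measurable M borel"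
    by (subst measurable_cong_sets[OF assms(2) refl]) (simp add: measurable_restrict_space1)
  have "snd \<in> borel_measurable (borel \<Otimes>\<^sub>M M)"
    by (rule measurable_compose[OF measurable_snd]) measurable
  then have "(\<lambda>p. k (fst p - snd p)) \<in> borel_measurable (borel \<Otimes>\<^sub>M M)"
    by (intro measurable_compose[OF _ assms(3)] borel_measurable_diff measurable_fst)
  moreover have "(\<lambda>p. \<psi> (snd p)) \<in> borel_measurable (borel \<Otimes>\<^sub>M M)"
    by measurable
  ultimately have "(\<lambda>p. k (fst p - snd p) * \<psi> (snd p)) \<in> borel_measurable (borel \<Otimes>\<^sub>M M)"
    by (rule borel_measurable_times)
  then show ?thesis
    by (intro borel_measurable_lebesgue_integral) (simp add: case_prod_unfold)
qed

section \<open>The squared norm and its powers on complex lines\<close>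

definition line_sq :: "'a::euclidean_space \<Rightarrow> 'a \<Rightarrow> complex \<Rightarrow> complex" where
  "line_sq x h s = of_real (x \<bullet> x) + 2 * s * of_real (x \<bullet> h) + s\<^sup>2 * of_real (h \<bullet> h)"

lemma line_sq_of_real: "line_sq x h (of_real s) = of_real ((norm (x + s *\<^sub>R h))\<^sup>2)"
proof -
  have "(norm (x + s *\<^sub>R h))\<^sup>2 = x \<bullet> x + 2 * s * (x \<bullet> h) + s\<^sup>2 * (h \<bullet> h)"
    unfolding power2_norm_eq_inner
    by (simp add: inner_add_left inner_add_right inner_commute power2_eq_square algebra_simps)
  then show ?thesis by (simp add: line_sq_def)
qed

text \<open>\<open>line_sq\<close> continues the square bilinearly, not sesquilinearly, so its real
  part is |x + Re s h|^2 - (Im s)^2 |h|^2. Since |Re s| and |Im s| are both at most |s|, the factor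
  2 in the hypothesis makes |x| - |Re s| |h| exceed |Im s| |h|.\<close>

lemma Re_line_sq_pos:
  assumes "2 * norm s * norm h < norm x"
  shows "Re (line_sq x h s) > 0"
proof -
  have "\<bar>Re s\<bar> * norm h \<le> norm s * norm h" "\<bar>Im s\<bar> * norm h \<le> norm s * norm h"
    by (auto intro!: mult_right_mono abs_Re_le_cmod abs_Im_le_cmod)
  then have "\<bar>Im s\<bar> * norm h < norm x - norm (Re s *\<^sub>R h)"
    using assms by simp
  also have "\<dots> \<le> norm (x + Re s *\<^sub>R h)" by (metis norm_diff_ineq)
  finally have "(\<bar>Im s\<bar> * norm h)\<^sup>2 < (norm (x + Re s *\<^sub>R h))\<^sup>2"
    by (intro power_strict_mono) auto
  moreover have "Re (line_sq x h s) = (norm (x + Re s *\<^sub>R h))\<^sup>2 - (\<bar>Im s\<bar> * norm h)\<^sup>2"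
    unfolding power_mult_distrib power2_norm_eq_inner power2_abs
    by (simp add: line_sq_def inner_add_left inner_add_right inner_commute
        power2_eq_square algebra_simps)
  ultimately show ?thesis by simp
qed

lemma line_sq_nonpos: "2 * norm s * norm h < norm x \<Longrightarrow> line_sq x h s \<notin> \<real>\<^sub>\<le>\<^sub>0"
  using Re_line_sq_pos[of s h x] by (auto simp: complex_nonpos_Reals_iff)

lemma holomorphic_line_sq: "line_sq x h holomorphic_on A"
  unfolding line_sq_def[abs_def] by (intro holomorphic_intros)

lemma continuous_on_line_sq: "continuous_on A (\<lambda>p. line_sq (fst p) h (snd p))"
  unfolding line_sq_def by (intro continuous_intros)

text \<open>The principal branch is holomorphic on the right half plane, where
  \<open>line_sq\<close> takes its values; halving undoes the square. The same reason puts
  \<open>a / 2\<close> into the exponent for powers of the norm.\<close>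

lemma line_kernel_ln_norm: "line_kernel (\<lambda>x. ln (norm x)) (\<lambda>x h s. Ln (line_sq x h s) / 2)"
  unfolding line_kernel_def
proof (intro conjI allI impI)
  fix x h :: 'a and s :: real
  assume *: "2 * \<bar>s\<bar> * norm h < norm x"
  then have "norm (x + s *\<^sub>R h) > 0"
    using Re_line_sq_pos[of "of_real s" h x] by (auto simp: line_sq_of_real)
  then show "Ln (line_sq x h (of_real s)) / 2 = of_real (ln (norm (x + s *\<^sub>R h)))"
    unfolding line_sq_of_real by (subst Ln_of_real) (auto simp: ln_realpow)
qed (auto intro!: holomorphic_intros continuous_intros holomorphic_line_sq continuous_on_line_sq
    line_sq_nonpos simp: case_prod_unfold)

lemma line_kernel_norm_powr: "line_kernel (\<lambda>x. norm x powr a) (\<lambda>x h s. line_sq x h s powr of_real (a / 2))"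
  unfolding line_kernel_def
proof (intro conjI allI impI)
  fix x h :: 'a and s :: real
  assume *: "2 * \<bar>s\<bar> * norm h < norm x"
  then have "norm (x + s *\<^sub>R h) > 0"
    using Re_line_sq_pos[of "of_real s" h x] by (auto simp: line_sq_of_real)
  then have "((norm (x + s *\<^sub>R h))\<^sup>2) powr (a / 2) = norm (x + s *\<^sub>R h) powr a"
    using powr_powr[of "norm (x + s *\<^sub>R h)" 2 "a / 2"] by simp
  then show "line_sq x h (of_real s) powr of_real (a / 2) = of_real (norm (x + s *\<^sub>R h) powr a)"
    unfolding line_sq_of_real by (subst powr_of_real) auto
next
  fix h :: 'a
  show "continuous_on {p. 2 * cmod (snd p) * norm h < norm (fst p)} (\<lambda>p. line_sq (fst p) h (snd p) powr of_real (a / 2))"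
  proof (rule continuous_on_powr_complex)
    \<comment> \<open>This condition concerns a vanishing base, which the positive real part of
      \<open>line_sq\<close> rules out.\<close>
    show "Re (of_real (a / 2)) > 0" if "p \<in> {p. 2 * cmod (snd p) * norm h < norm (fst p)}"
      "line_sq (fst p) h (snd p) = 0" for p
      using Re_line_sq_pos[of "snd p" h "fst p"] that by simp
    show "{p. 2 * cmod (snd p) * norm h < norm (fst p)} \<subseteq>
        {p. 0 \<le> Re (line_sq (fst p) h (snd p)) \<or> Im (line_sq (fst p) h (snd p)) \<noteq> 0}"
      using Re_line_sq_pos by (fastforce intro: less_imp_le)
  qed (rule continuous_on_line_sq continuous_on_const)+
next
  fix x h :: 'a
  show "(\<lambda>s. line_sq x h s powr of_real (a / 2)) holomorphic_on {s. 2 * norm s * norm h < norm x}"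
    by (intro holomorphic_on_powr holomorphic_line_sq line_sq_nonpos holomorphic_on_const) simp
qed

lemma line_kernel_inner: "line_kernel (\<lambda>x. v \<bullet> x) (\<lambda>x h s. of_real (v \<bullet> x) + s * of_real (v \<bullet> h))"
  unfolding line_kernel_def
  by (auto intro!: holomorphic_intros continuous_intros simp: inner_add_right)

lemma line_kernel_mult:
  assumes "line_kernel k kc" "line_kernel l lc"
  shows "line_kernel (\<lambda>x. k x * l x) (\<lambda>x h s. kc x h s * lc x h s)"
  using assms unfolding line_kernel_def by (auto intro!: holomorphic_intros continuous_intros)

lemma line_kernel_cmult:
  assumes "line_kernel k kc"
  shows "line_kernel (\<lambda>x. c * k x) (\<lambda>x h s. of_real c * kc x h s)"
  using assms unfolding line_kernel_def by (auto intro!: holomorphic_intros continuous_intros)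

section \<open>The fundamental solution, its gradient and the dipole kernel\<close>

lemma line_kernel_fundamental_solution:
  "\<exists>kc. line_kernel (fundamental_solution :: 'a::euclidean_space \<Rightarrow> real) kc"
proof (cases "DIM('a) = 2")
  case True
  then show ?thesis
    using line_kernel_cmult[OF line_kernel_ln_norm, where c = "1 / (2 * pi)"]
    by (auto simp: fundamental_solution_def[abs_def])
next
  case False
  then show ?thesis
    using line_kernel_cmult[OF line_kernel_norm_powr[where a = "2 - real DIM('a)"],
        where c = "- 1 / (real DIM('a) * (real DIM('a) - 2) * unit_ball_vol (real DIM('a)))"]
    by (auto simp: fundamental_solution_def[abs_def])
qed

text \<open>This is the derivative of the fundamental solution in direction \<open>v\<close> in
  closed form. The same formula serves dimension two, because there d c_d = 2 pi.\<close>

definition dipole_kernel :: "'a::euclidean_space \<Rightarrow> 'a \<Rightarrow> real" where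
  "dipole_kernel v x = 1 / (real DIM('a) * unit_ball_vol (real DIM('a))) * ((v \<bullet> x) * norm x powr (- real DIM('a)))"

lemma line_kernel_dipole: "\<exists>kc. line_kernel (dipole_kernel v) kc"
  unfolding dipole_kernel_def[abs_def]
  using line_kernel_cmult[OF line_kernel_mult[OF line_kernel_inner line_kernel_norm_powr]] by blast

lemma fundamental_solution_measurable [measurable]: "fundamental_solution \<in> borel_measurable borel"
  unfolding fundamental_solution_def[abs_def] by measurable

lemma dipole_kernel_measurable [measurable]: "dipole_kernel v \<in> borel_measurable borel"
  unfolding dipole_kernel_def[abs_def] by measurable

text \<open>The function is radial, and in both cases of its definition the radial derivative is
  r^(1 - d) / (d c_d). The chain rule with the gradient x / |x| of the norm does the rest.\<close>

lemma GDERIV_fundamental_solution: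
  fixes x :: "'a::euclidean_space"
  assumes "DIM('a) \<ge> 2" "x \<noteq> 0"
  shows "GDERIV fundamental_solution x :>
    (1 / (real DIM('a) * unit_ball_vol (real DIM('a))) * norm x powr (- real DIM('a))) *\<^sub>R x"
proof -
  define d where "d = real DIM('a)"
  define \<Gamma> :: "real \<Rightarrow> real" where "\<Gamma> r = (if d = 2 then 1 / (2 * pi) * ln r
      else - 1 / (d * (d - 2) * unit_ball_vol d) * r powr (2 - d))" for r
  have eq: "fundamental_solution = (\<lambda>x::'a. \<Gamma> (norm x))"
    by (auto simp: fundamental_solution_def \<Gamma>_def d_def)
  have r: "norm x > 0" using assms by simp
  have "d \<ge> 2" using assms by (simp add: d_def)
  have "DERIV \<Gamma> (norm x) :> 1 / (d * unit_ball_vol d) * norm x powr (1 - d)"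
  proof (cases "d = 2")
    case True
    have "DERIV (\<lambda>r. 1 / (2 * pi) * ln r) (norm x) :> 1 / (2 * pi) * (1 / norm x)"
      using r by (auto intro!: derivative_eq_intros)
    then show ?thesis
      using True r unfolding \<Gamma>_def by (simp add: unit_ball_vol_2 powr_minus_divide)
  next
    case False
    have "DERIV (\<lambda>r. r powr (2 - d)) (norm x) :> (2 - d) * norm x powr (2 - d - 1)"
      using r by (rule has_real_derivative_powr)
    then have "DERIV (\<lambda>r. - 1 / (d * (d - 2) * unit_ball_vol d) * r powr (2 - d)) (norm x) :>
       - 1 / (d * (d - 2) * unit_ball_vol d) * ((2 - d) * norm x powr (2 - d - 1))"
      by (rule DERIV_cmult)
    moreover have "- 1 / (d * (d - 2) * unit_ball_vol d) * ((2 - d) * norm x powr (2 - d - 1))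
       = 1 / (d * unit_ball_vol d) * norm x powr (1 - d)"
    proof -
      have "d \<noteq> 0" "d - 2 \<noteq> 0" "unit_ball_vol d \<noteq> 0"
        using False \<open>d \<ge> 2\<close> less_imp_neq[OF unit_ball_vol_pos[of d]] by auto
      moreover have "2 - d - 1 = 1 - d" by simp
      ultimately show ?thesis by (simp add: divide_simps) (simp add: algebra_simps)
    qed
    ultimately show ?thesis using False unfolding \<Gamma>_def by simp
  qed
  from GDERIV_DERIV_compose[OF GDERIV_norm[OF assms(2)] this]
  have "GDERIV fundamental_solution x :> (1 / (d * unit_ball_vol d) * norm x powr (1 - d)) *\<^sub>R sgn x"
    unfolding eq .
  moreover have "norm x powr (1 - d) * inverse (norm x) = norm x powr (- d)"
    using r by (simp add: powr_diff powr_minus_divide divide_inverse)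
  then have "(1 / (d * unit_ball_vol d) * norm x powr (1 - d)) *\<^sub>R sgn x =
      (1 / (d * unit_ball_vol d) * norm x powr (- d)) *\<^sub>R x"
    by (simp add: sgn_div_norm mult.assoc)
  ultimately show ?thesis by (simp add: d_def)
qed

lemma dipole_source_eq:
  fixes z :: "'a::euclidean_space"
  assumes "DIM('a) \<ge> 2" "z \<noteq> x"
  shows "dipole_source v z x = dipole_kernel v (z - x)"
proof -
  define D where "D = (1 / (real DIM('a) * unit_ball_vol (real DIM('a))) * norm (z - x) powr (- real DIM('a))) *\<^sub>R (z - x)"
  have "(fundamental_solution has_derivative (\<lambda>h. h \<bullet> D)) (at (z - x))"
    using GDERIV_fundamental_solution[OF assms(1), of "z - x"] assms(2) by (simp add: D_def gderiv_def)
  moreover have "((\<lambda>w. w - x) has_derivative (\<lambda>h. h)) (at z)"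
    by (auto intro!: derivative_eq_intros)
  ultimately have *: "GDERIV (\<lambda>w. fundamental_solution (w - x)) z :> D"
    unfolding gderiv_def by (rule has_derivative_compose[rotated])
  \<comment> \<open>\<open>gradient\<close> is a definite description, so uniqueness has to be
    proved along with existence.\<close>
  have "gradient (\<lambda>w. fundamental_solution (w - x)) z = D"
    unfolding gradient_def
  proof (rule the_equality)
    show "GDERIV (\<lambda>w. fundamental_solution (w - x)) z :> D" by (rule *)
  next
    fix D' assume "GDERIV (\<lambda>w. fundamental_solution (w - x)) z :> D'"
    then have "(\<lambda>h. h \<bullet> D') = (\<lambda>h. h \<bullet> D)"
      using * unfolding gderiv_def by (rule has_derivative_unique)
    then have "\<forall>h. h \<bullet> D' = h \<bullet> D" by (simp add: fun_eq_iff)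
    then show "D' = D" by (simp only: vector_eq_ldot)
  qed
  then show ?thesis by (simp add: dipole_source_def dipole_kernel_def D_def)
qed

text \<open>The derivative of the holomorphic extension at 0 is an integral of
  \<open>deriv (kc (z - y) v) 0\<close>. As \<open>kc\<close> is known only by its values on the
  real axis, this number is identified by uniqueness of the derivative of the real
  restriction.\<close>

lemma single_layer_line_derivative:
  fixes M :: "'a::euclidean_space measure"
  assumes "DIM('a) \<ge> 2" and F: "compact F" "sets M = sets (restrict_space borel F)"
    and \<psi>: "integrable M \<psi>" and z: "z \<notin> F"
  shows "((\<lambda>s. \<integral>y. fundamental_solution (z + s *\<^sub>R v - y) * \<psi> y \<partial>M) has_real_derivative
    (\<integral>y. dipole_kernel v (z - y) * \<psi> y \<partial>M)) (at 0)"
proof -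
  obtain kc where kc: "line_kernel (fundamental_solution :: 'a \<Rightarrow> real) kc"
    using line_kernel_fundamental_solution by blast
  have space: "space M = F"
    using sets_eq_imp_space_eq[OF F(2)] by (simp add: space_restrict_space)
  have deriv_kc: "deriv (kc x v) 0 = of_real (dipole_kernel v x)" if x: "x \<noteq> 0" for x
  proof -
    define r where "r = norm x / (2 * (norm v + 1))"
    have r: "r > 0" using x by (simp add: r_def add_nonneg_pos)
    have small: "2 * norm s * norm v < norm x" if "norm s < r" for s :: complex
      using less_of_norm_le_divide[of "norm x" s v] x that by (simp add: r_def)
    have "kc x v holomorphic_on ball 0 r"
    proof (rule holomorphic_on_subset)
      show "kc x v holomorphic_on {s. 2 * norm s * norm v < norm x}"
        using kc unfolding line_kernel_def by blast
    qed (use small in auto)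
    then have "(kc x v has_field_derivative deriv (kc x v) 0) (at (of_real 0))"
      using r holomorphic_derivI[of "kc x v" "ball 0 r" 0] by simp
    then have "((\<lambda>s. kc x v (of_real s)) has_vector_derivative deriv (kc x v) 0) (at (0::real))"
      by (rule has_vector_derivative_real_field)
    then have 1: "((\<lambda>s::real. complex_of_real (fundamental_solution (x + s *\<^sub>R v))) has_vector_derivative deriv (kc x v) 0) (at 0)"
    proof (rule has_vector_derivative_transform_within_open[of _ _ _ "ball 0 r"])
      fix s :: real assume "s \<in> ball 0 r"
      then have "2 * \<bar>s\<bar> * norm v < norm x" using small[of "of_real s"] by simp
      then show "kc x v (of_real s) = of_real (fundamental_solution (x + s *\<^sub>R v))"
        using kc unfolding line_kernel_def by blast
    qed (use r in auto)
    have "(fundamental_solution has_derivative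
        (\<lambda>h. h \<bullet> ((1 / (real DIM('a) * unit_ball_vol (real DIM('a))) * norm x powr (- real DIM('a))) *\<^sub>R x))) (at (x + 0 *\<^sub>R v))"
      using GDERIV_fundamental_solution[OF assms(1) x] by (simp add: gderiv_def)
    moreover have "((\<lambda>s. x + s *\<^sub>R v) has_derivative (\<lambda>s. s *\<^sub>R v)) (at 0)"
      by (auto intro!: derivative_eq_intros)
    ultimately have "((\<lambda>s::real. fundamental_solution (x + s *\<^sub>R v)) has_derivative
        (\<lambda>s. (s *\<^sub>R v) \<bullet> ((1 / (real DIM('a) * unit_ball_vol (real DIM('a))) * norm x powr (- real DIM('a))) *\<^sub>R x))) (at 0)"
      by (rule has_derivative_compose[rotated])
    then have "((\<lambda>s::real. fundamental_solution (x + s *\<^sub>R v)) has_vector_derivative dipole_kernel v x) (at 0)"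
      unfolding has_vector_derivative_def by (simp add: dipole_kernel_def mult_ac)
    then have "((\<lambda>s::real. complex_of_real (fundamental_solution (x + s *\<^sub>R v))) has_vector_derivative of_real (dipole_kernel v x)) (at 0)"
      by (rule bounded_linear.has_vector_derivative[OF bounded_linear_of_real])
    with 1 show ?thesis by (rule vector_derivative_unique_at)
  qed
  obtain \<delta> f where \<delta>: "\<delta> > 0"
    and f: "\<And>s::real. \<bar>s\<bar> < \<delta> \<Longrightarrow> f (of_real s) = of_real (\<integral>y. fundamental_solution (z + s *\<^sub>R v - y) * \<psi> y \<partial>M)"
    and df0: "(f has_field_derivative (\<integral>y. deriv (kc (z - y) v) 0 * of_real (\<psi> y) \<partial>M)) (at 0)"
    using line_kernel_potential[OF kc F \<psi> z, where h = v] by blast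
  have df: "(f has_field_derivative (\<integral>y. deriv (kc (z - y) v) 0 * of_real (\<psi> y) \<partial>M)) (at (of_real 0))"
    using df0 by simp
  have "(\<integral>y. deriv (kc (z - y) v) 0 * of_real (\<psi> y) \<partial>M) = (\<integral>y. complex_of_real (dipole_kernel v (z - y) * \<psi> y) \<partial>M)"
  proof (intro Bochner_Integration.integral_cong refl)
    fix y assume "y \<in> space M"
    then have "z - y \<noteq> 0" using z space by auto
    then show "deriv (kc (z - y) v) 0 * of_real (\<psi> y) = complex_of_real (dipole_kernel v (z - y) * \<psi> y)"
      by (simp add: deriv_kc)
  qed
  then have "((\<lambda>s. f (of_real s)) has_vector_derivative of_real (\<integral>y. dipole_kernel v (z - y) * \<psi> y \<partial>M)) (at (0::real))"
    using has_vector_derivative_real_field[OF df] by (simp only: integral_complex_of_real)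
  then have "((\<lambda>s. complex_of_real (\<integral>y. fundamental_solution (z + s *\<^sub>R v - y) * \<psi> y \<partial>M)) has_vector_derivative
      of_real (\<integral>y. dipole_kernel v (z - y) * \<psi> y \<partial>M)) (at 0)"
    by (rule has_vector_derivative_transform_within_open[of _ _ _ "ball 0 \<delta>"]) (use \<delta> f in auto)
  \<comment> \<open>Taking real parts returns from the complex-valued curve to the real
    potential.\<close>
  from bounded_linear.has_vector_derivative[OF bounded_linear_Re this]
  show ?thesis by (simp add: has_real_derivative_iff_has_vector_derivative)
qed

subsection \<open>The surface measure\<close>

abbreviation tangential :: "'a::real_inner \<Rightarrow> 'a \<Rightarrow> 'a" where
  "tangential e x \<equiv> x - (x \<bullet> e) *\<^sub>R e"

lemma norm_tangential_le: "norm e = 1 \<Longrightarrow> norm (tangential e x) \<le> 2 * norm x"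
  using norm_triangle_ineq4[of x "(x \<bullet> e) *\<^sub>R e"] Cauchy_Schwarz_ineq2[of x e] by simp

lemma tangential_diff: "tangential e x - tangential e y = tangential e (x - y)"
  by (simp add: inner_diff_left algebra_simps)

text \<open>A boundary chart reduced to a Lipschitz graph. The Lipschitz estimate is phrased through
  projections of points of the ball, the arguments at which \<open>g\<close> describes the
  domain.\<close>

locale boundary_graph =
  fixes \<Omega> :: "'a::euclidean_space set" and p e :: 'a and r :: real and g :: "'a \<Rightarrow> real" and L :: real
  assumes open_domain: "open \<Omega>"
    and e: "norm e = 1" and r: "r > 0" and L: "L \<ge> 0"
    and cont: "\<And>w. isCont g w"
    and lipschitz: "\<And>x y. x \<in> ball p r \<Longrightarrow> y \<in> ball p r \<Longrightarrow>
       \<bar>g (tangential e x) - g (tangential e y)\<bar> \<le> L * norm (tangential e (x - y))"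
    and graph: "\<Omega> \<inter> ball p r = {x \<in> ball p r. x \<bullet> e > g (tangential e x)}"
begin

text \<open>The chart describes the domain itself, not its closure. The points strictly below the
  graph form an open set disjoint from the domain, hence disjoint from its closure as well.\<close>

lemma below_graph_exterior:
  assumes "x \<in> ball p r" "x \<bullet> e < g (tangential e x)"
  shows "x \<notin> closure \<Omega>"
proof -
  define V where "V = {x \<in> ball p r. x \<bullet> e < g (tangential e x)}"
  have "continuous_on UNIV (\<lambda>x. g (tangential e x))"
    by (rule continuous_on_compose2[of UNIV g]) (auto intro!: continuous_intros continuous_at_imp_continuous_on cont)
  then have "open {x. x \<bullet> e < g (tangential e x)}"
    by (intro open_Collect_less continuous_intros) auto
  then have "open V"
    unfolding V_def Collect_conj_eq by (intro open_Int) (simp_all only: Collect_mem_eq open_ball)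
  moreover have "V \<inter> \<Omega> = {}"
  proof (rule ccontr)
    assume "V \<inter> \<Omega> \<noteq> {}"
    then obtain y where y: "y \<in> ball p r" "y \<in> \<Omega>" "y \<bullet> e < g (tangential e y)" by (auto simp: V_def)
    then have "y \<in> \<Omega> \<inter> ball p r" by blast
    then show False using y unfolding graph by simp
  qed
  ultimately have "V \<inter> closure \<Omega> = {}" by (simp only: open_Int_closure_eq_empty)
  moreover have "x \<in> V" using assms by (simp add: V_def)
  ultimately show ?thesis by blast
qed

lemma frontier_in_graph:
  assumes "x \<in> frontier \<Omega>" "x \<in> ball p r"
  shows "x \<bullet> e = g (tangential e x)"
proof (rule ccontr)
  assume ne: "x \<bullet> e \<noteq> g (tangential e x)"
  have x: "x \<in> closure \<Omega>" "x \<notin> \<Omega>"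
    using assms(1) open_domain by (auto simp: frontier_def interior_open)
  then have "x \<notin> {x \<in> ball p r. x \<bullet> e > g (tangential e x)}" unfolding graph[symmetric] by blast
  then show False
    using below_graph_exterior[OF assms(2)] x(1) assms(2) ne by (auto simp: not_less_iff_gr_or_eq)
qed

text \<open>For two points of the graph, the component along \<open>e\<close> is a difference of
  values of \<open>g\<close>, so the tangential component controls the whole distance.\<close>

lemma graph_bilipschitz:
  assumes "x \<in> frontier \<Omega>" "x \<in> ball p r" "y \<in> frontier \<Omega>" "y \<in> ball p r"
  shows "norm (x - y) \<le> (1 + L) * norm (tangential e (x - y))"
proof -
  have "(x - y) \<bullet> e = g (tangential e x) - g (tangential e y)"
    using frontier_in_graph assms by (simp add: inner_diff_left)
  then have "\<bar>(x - y) \<bullet> e\<bar> \<le> L * norm (tangential e (x - y))"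
    using lipschitz[OF assms(2,4)] by simp
  moreover have "norm (x - y) \<le> norm (tangential e (x - y)) + norm (((x - y) \<bullet> e) *\<^sub>R e)"
    using norm_triangle_ineq[of "tangential e (x - y)" "((x - y) \<bullet> e) *\<^sub>R e"] by simp
  ultimately show ?thesis using e unfolding distrib_right norm_scaleR by simp
qed

end

lemma boundary_graph_exists:
  fixes \<Omega> :: "'a::euclidean_space set"
  assumes "\<alpha> > 0" "C1_holder_boundary \<alpha> \<Omega>" "p \<in> frontier \<Omega>" "open \<Omega>"
  obtains e r g L where "boundary_graph \<Omega> p e r g L"
proof -
  from assms(2,3) obtain e r g Dg C where e: "norm e = 1" and r: "r > 0"
    and g: "\<And>w. GDERIV g w :> Dg w"
    and Dg: "\<And>w w'. norm (Dg w - Dg w') \<le> C * norm (w - w') powr \<alpha>"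
    and eq: "\<Omega> \<inter> ball p r = {x \<in> ball p r. x \<bullet> e > g (tangential e x)}"
    unfolding C1_holder_boundary_def by blast
  \<comment> \<open>\<open>R\<close> is chosen so that the projections of all points of
    \<open>ball p r\<close> lie in \<open>cball 0 R\<close>. The Hoelder estimate from the origin
    bounds the gradient there by the \<open>L\<close> below, and the mean value inequality makes
    this a Lipschitz constant.\<close>
  define R where "R = 2 * (norm p + r)"
  define L where "L = norm (Dg 0) + \<bar>C\<bar> * R powr \<alpha>"
  have Dg_le: "norm (Dg w) \<le> L" if "w \<in> cball 0 R" for w
  proof -
    have "C * norm w powr \<alpha> \<le> \<bar>C\<bar> * R powr \<alpha>"
      using that assms(1) by (intro mult_mono powr_mono2) auto
    then show ?thesis
      using Dg[of w 0] norm_triangle_sub[of "Dg w" "Dg 0"] by (simp add: L_def)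
  qed
  have lip: "norm (g x - g y) \<le> L * norm (x - y)" if "x \<in> cball 0 R" "y \<in> cball 0 R" for x y
  proof (rule differentiable_bound[OF convex_cball _ _ that])
    fix w :: 'a assume w: "w \<in> cball 0 R"
    show "(g has_derivative (\<lambda>h. h \<bullet> Dg w)) (at w within cball 0 R)"
      using g[of w] has_derivative_at_withinI unfolding gderiv_def by blast
    show "onorm (\<lambda>h. h \<bullet> Dg w) \<le> L"
    proof (rule onorm_le)
      fix h
      have "norm (h \<bullet> Dg w) \<le> norm h * norm (Dg w)" using Cauchy_Schwarz_ineq2 by simp
      also have "\<dots> \<le> L * norm h" 
        using mult_right_mono[OF Dg_le[OF w] norm_ge_zero[of h]] by (simp add: mult.commute)
      finally show "norm (h \<bullet> Dg w) \<le> L * norm h" .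
    qed
  qed
  have inR: "tangential e x \<in> cball 0 R" if "x \<in> ball p r" for x
  proof -
    have "norm x \<le> norm p + r"
      using that norm_triangle_sub[of x p] by (simp add: dist_norm norm_minus_commute)
    then show ?thesis using norm_tangential_le[OF e, of x] by (simp add: R_def)
  qed
  have "boundary_graph \<Omega> p e r g L"
  proof
    show "open \<Omega>" "norm e = 1" "r > 0" by fact+
    show "L \<ge> 0" by (simp add: L_def)
    show "isCont g w" for w
      using g[of w] has_derivative_continuous unfolding gderiv_def by blast
    show "\<bar>g (tangential e x) - g (tangential e y)\<bar> \<le> L * norm (tangential e (x - y))"
      if "x \<in> ball p r" "y \<in> ball p r" for x y
      using lip[OF inR[OF that(1)] inR[OF that(2)]] by (simp only: tangential_diff real_norm_def)
    show "\<Omega> \<inter> ball p r = {x \<in> ball p r. x \<bullet> e > g (tangential e x)}" by (rule eq)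
  qed
  then show thesis by (rule that)
qed

text \<open>Cover \<open>A\<close> by the preimages of the cells of a grid of mesh \<open>2R/N\<close> in the hyperplane \<open>e\<^sup>\<bottom>\<close>.\<close>
lemma hausdorff_outer_lipschitz_graph_finite:
  fixes A :: "'a::euclidean_space set"
  assumes dim: "DIM('a) \<ge> 2" and e: "norm e = 1" and bdd: "bounded A"
    and lip: "\<And>x y. x \<in> A \<Longrightarrow> y \<in> A \<Longrightarrow> norm (x - y) \<le> L * norm (tangential e (x - y))" and "L > 0"
  shows "hausdorff_outer (DIM('a) - 1) A < \<infinity>"
proof -
  define m where "m = DIM('a) - 1"
  have m: "m \<ge> 1" using dim by (simp add: m_def)
  have "e \<noteq> 0" using e by auto
  obtain B where B: "B \<subseteq> {x. e \<bullet> x = 0}" "pairwise orthogonal B"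
    "\<And>b. b \<in> B \<Longrightarrow> norm b = 1" "independent B" "card B = dim {x. e \<bullet> x = 0}" "span B = {x. e \<bullet> x = 0}"
    using orthonormal_basis_subspace[OF subspace_hyperplane] by blast
  have cardB: "card B = m" using B(5) dim_hyperplane[OF \<open>e \<noteq> 0\<close>] by (simp add: m_def)
  have finB: "finite B" using B(4) independent_imp_finite by blast
  obtain R where R: "R > 0" "\<And>x. x \<in> A \<Longrightarrow> norm x \<le> R"
    using bdd bounded_pos by blast
  \<comment> \<open>A cell of side 2R / N in m orthonormal directions has diameter at most m 2R / N;
    the factor \<open>L\<close> lifts this to the graph. So every piece has diameter at most
    \<open>D / real N\<close>.\<close>
  define D where "D = L * (real m * (2 * R))"
  have "D > 0" using m R \<open>L > 0\<close> by (simp add: D_def)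
  define c where "c = unit_ball_vol (real m)"
  have "c \<ge> 0" by (simp add: c_def)
  have cover: "\<exists>U. A \<subseteq> (\<Union>i. U i) \<and> (\<forall>i. bounded (U i) \<and> diameter (U i) \<le> \<delta>) \<and>
      (\<Sum>i. ennreal (c * (diameter (U i) / 2) ^ m)) \<le> ennreal (c * D ^ m)" if "\<delta> > 0" for \<delta>
  proof -
    obtain N :: nat where N: "N > 0" "D / real N \<le> \<delta>"
    proof -
      obtain N :: nat where N: "D / \<delta> < real N" using reals_Archimedean2 by blast
      then have "N > 0" using \<open>D > 0\<close> \<open>\<delta> > 0\<close> by (metis divide_pos_pos less_trans of_nat_0_less_iff)
      moreover have "D / real N \<le> \<delta>"
        using N \<open>\<delta> > 0\<close> \<open>N > 0\<close> by (simp add: field_simps)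
      ultimately show thesis by (rule that)
    qed
    \<comment> \<open>Coordinates in [-R, R] are rescaled to [0, N] and rounded down. The end point
      R gets the index N, hence N + 1 indices per direction.\<close>
    define idx where "idx x = (\<lambda>b\<in>B. nat \<lfloor>(x \<bullet> b + R) * real N / (2 * R)\<rfloor>)" for x
    define P where "P = (\<Pi>\<^sub>E b\<in>B. {..N})"
    have finP: "finite P" using finB by (simp add: P_def finite_PiE)
    have cardP: "card P = (N + 1) ^ m" using finB cardB by (simp add: P_def card_PiE)
    have coord: "\<bar>x \<bullet> b\<bar> \<le> R" if "x \<in> A" "b \<in> B" for x b
      using Cauchy_Schwarz_ineq2[of x b] B(3)[OF that(2)] R(2)[OF that(1)] by simp
    have idxP: "idx x \<in> P" if "x \<in> A" for x
    proof -
      have "nat \<lfloor>(x \<bullet> b + R) * real N / (2 * R)\<rfloor> \<le> N" if "b \<in> B" for b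
      proof -
        have "(x \<bullet> b + R) * real N \<le> (2 * R) * real N"
          using coord[OF \<open>x \<in> A\<close> that] by (intro mult_right_mono) auto
        then have "(x \<bullet> b + R) * real N / (2 * R) \<le> real N"
          using R(1) by (simp add: divide_le_eq mult.commute)
        then show ?thesis by linarith
      qed
      then show ?thesis by (auto simp: idx_def P_def)
    qed
    have cell: "norm (x - y) \<le> D / real N" if "x \<in> A" "y \<in> A" "idx x = idx y" for x y
    proof -
      define h where "h = tangential e (x - y)"
      have close: "\<bar>h \<bullet> b\<bar> \<le> 2 * R / real N" if "b \<in> B" for b
      proof -
        have "e \<bullet> b = 0" using B(1) that by auto
        then have hb: "h \<bullet> b = x \<bullet> b - y \<bullet> b" by (simp add: h_def inner_diff_left)
        have "nat \<lfloor>(x \<bullet> b + R) * real N / (2 * R)\<rfloor> = nat \<lfloor>(y \<bullet> b + R) * real N / (2 * R)\<rfloor>"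
          using fun_cong[OF \<open>idx x = idx y\<close>, of b] that by (simp add: idx_def)
        moreover have "(x \<bullet> b + R) * real N / (2 * R) \<ge> 0" "(y \<bullet> b + R) * real N / (2 * R) \<ge> 0"
          using coord[OF \<open>x \<in> A\<close> that] coord[OF \<open>y \<in> A\<close> that] R(1) by (auto intro!: divide_nonneg_nonneg mult_nonneg_nonneg)
        ultimately have "\<bar>(x \<bullet> b + R) * real N / (2 * R) - (y \<bullet> b + R) * real N / (2 * R)\<bar> \<le> 1"
          by linarith
        moreover have "(x \<bullet> b + R) * real N / (2 * R) - (y \<bullet> b + R) * real N / (2 * R) = (h \<bullet> b) * (real N / (2 * R))"
          by (simp add: hb diff_divide_distrib[symmetric] left_diff_distrib[symmetric])
        ultimately have "\<bar>h \<bullet> b\<bar> * (real N / (2 * R)) \<le> 1"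
          using R(1) by (simp add: abs_mult)
        then show ?thesis using N(1) R(1) by (simp add: field_simps)
      qed
      have "e \<bullet> e = 1" using e by (simp add: dot_square_norm)
      then have "h \<in> span B" unfolding B(6) by (simp add: h_def inner_diff_right inner_commute)
      then have "h = (\<Sum>b\<in>B. (h \<bullet> b) *\<^sub>R b)"
        using orthonormal_basis_expand[OF B(2,3) _ finB] by simp
      then have "norm h \<le> (\<Sum>b\<in>B. norm ((h \<bullet> b) *\<^sub>R b))" by (metis norm_sum)
      also have "\<dots> = (\<Sum>b\<in>B. \<bar>h \<bullet> b\<bar>)" using B(3) by simp
      also have "\<dots> \<le> real (card B) * (2 * R / real N)" by (intro sum_bounded_above close)
      finally have "norm h \<le> real m * (2 * R / real N)" using cardB by simp
      then have "L * norm h \<le> L * (real m * (2 * R / real N))"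
        using \<open>L > 0\<close> by (intro mult_left_mono) auto
      then show ?thesis using lip[OF that(1,2)] by (simp add: D_def h_def)
    qed
    obtain f where f: "bij_betw f {0..<card P} P" using ex_bij_betw_nat_finite[OF finP] by blast
    define U where "U i = (if i < card P then {x \<in> A. idx x = f i} else {})" for i
    have diam: "diameter (U i) \<le> D / real N" for i
      using cell \<open>D > 0\<close> by (intro diameter_le) (auto simp: U_def split: if_splits)
    have "x \<in> (\<Union>i. U i)" if "x \<in> A" for x
      using idxP[OF that] bij_betw_imp_surj_on[OF f] that by (force simp: U_def image_iff)
    moreover have bd: "bounded (U i)" for i using bounded_subset[OF bdd] by (auto simp: U_def)
    moreover have "diameter (U i) \<le> \<delta>" for i using diam[of i] N(2) by linarith
    moreover have "(\<Sum>i. ennreal (c * (diameter (U i) / 2) ^ m)) \<le> ennreal (c * D ^ m)"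
    proof -
      have "(\<Sum>i. ennreal (c * (diameter (U i) / 2) ^ m)) = (\<Sum>i<card P. ennreal (c * (diameter (U i) / 2) ^ m))"
        \<comment> \<open>The padding sets are empty with diameter 0, and their terms vanish because
          \<open>m \<ge> 1\<close>; \<open>0 ^ 0\<close> would be 1.\<close>
        using m by (intro suminf_finite) (auto simp: U_def zero_power)
      also have "\<dots> \<le> (\<Sum>i<card P. ennreal (c * (D / real N / 2) ^ m))"
        using diam diameter_ge_0[OF bd] \<open>c \<ge> 0\<close>
        by (intro sum_mono ennreal_leI mult_left_mono power_mono divide_right_mono) auto
      also have "\<dots> = ennreal (real (card P) * (c * (D / real N / 2) ^ m))"
        by (simp add: ennreal_mult' ennreal_of_nat_eq_real_of_nat)
      also have "\<dots> \<le> ennreal (c * D ^ m)"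
      proof (rule ennreal_leI)
        have "real (card P) * (c * (D / real N / 2) ^ m) = c * (real (N + 1) * (D / real N / 2)) ^ m"
          unfolding cardP of_nat_power power_mult_distrib by (simp only: mult.left_commute)
        also have "\<dots> \<le> c * D ^ m"
        proof (intro mult_left_mono power_mono \<open>c \<ge> 0\<close>)
          \<comment> \<open>The 2 in the half-diameter absorbs the surplus index: N + 1 <= 2 N.
            Hence the bound does not depend on the mesh.\<close>
          have "real (N + 1) * D \<le> (2 * real N) * D"
            using N(1) \<open>D > 0\<close> by (intro mult_right_mono) auto
          then show "real (N + 1) * (D / real N / 2) \<le> D"
            using N(1) by (simp add: field_simps)
        qed (use \<open>D > 0\<close> in auto)
        finally show "real (card P) * (c * (D / real N / 2) ^ m) \<le> c * D ^ m" .
      qed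
      finally show ?thesis .
    qed
    ultimately show ?thesis by (intro exI[of _ U]) blast
  qed
  have "hausdorff_outer m A \<le> ennreal (c * D ^ m)"
    unfolding hausdorff_outer_def
  proof (rule SUP_least)
    fix \<delta> :: real assume "\<delta> \<in> {0<..}"
    then obtain U where "A \<subseteq> (\<Union>i. U i)" "\<forall>i. bounded (U i) \<and> diameter (U i) \<le> \<delta>"
      "(\<Sum>i. ennreal (c * (diameter (U i) / 2) ^ m)) \<le> ennreal (c * D ^ m)"
      using cover[of \<delta>] by auto
    then show "(INF U\<in>{U. A \<subseteq> (\<Union>i. U i) \<and> (\<forall>i. bounded (U i) \<and> diameter (U i) \<le> \<delta>)}.
        \<Sum>i. ennreal (unit_ball_vol (real m) * (diameter (U i) / 2) ^ m)) \<le> ennreal (c * D ^ m)"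
      unfolding c_def by (intro INF_lower2[of U]) auto
  qed
  then show ?thesis by (simp add: m_def le_less_trans)
qed

section \<open>Null points and total mass of the surface measure\<close>

lemma hausdorff_outer_singleton: "m \<ge> 1 \<Longrightarrow> hausdorff_outer m {x} = 0"
  unfolding hausdorff_outer_def
  by (intro antisym SUP_least INF_lower2[of "\<lambda>_. {x}"]) (auto simp: zero_power)

lemma sets_hausdorff_measure: "sets (hausdorff_measure m) = sets borel"
  unfolding hausdorff_measure_def by (metis sets.sets_measure_of_eq space_borel)

text \<open>\<open>measure_of\<close> assigns to a set either its outer measure or 0, and the
  inequality holds in both cases.\<close>

lemma emeasure_hausdorff_measure_le: "emeasure (hausdorff_measure m) A \<le> hausdorff_outer m A"
  unfolding hausdorff_measure_def by (simp add: emeasure_measure_of_conv)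

lemma sets_surface_measure: "sets (surface_measure \<Omega>) = sets (restrict_space borel (frontier \<Omega>))"
  unfolding surface_measure_def by (intro sets_restrict_space_cong sets_hausdorff_measure)

lemma space_surface_measure: "space (surface_measure \<Omega>) = frontier \<Omega>"
  using sets_eq_imp_space_eq[OF sets_surface_measure[of \<Omega>]] by (simp add: space_restrict_space)

lemma emeasure_surface_measure_le:
  fixes \<Omega> :: "'a::euclidean_space set"
  assumes "A \<subseteq> frontier \<Omega>"
  shows "emeasure (surface_measure \<Omega>) A \<le> hausdorff_outer (DIM('a) - 1) A"
proof -
  have "frontier \<Omega> \<inter> space (hausdorff_measure (DIM('a) - 1)) \<in> sets (hausdorff_measure (DIM('a) - 1) :: 'a measure)"
    unfolding sets_hausdorff_measure sets_eq_imp_space_eq[OF sets_hausdorff_measure] by simp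
  then show ?thesis
    unfolding surface_measure_def using assms
    by (subst emeasure_restrict_space) (auto intro: emeasure_hausdorff_measure_le)
qed

text \<open>Lets the singularity of the kernel at \<open>y = x\<close> be ignored when
  \<open>x\<close> is a boundary point.\<close>

lemma AE_surface_measure_neq:
  fixes x :: "'a::euclidean_space"
  assumes "DIM('a) \<ge> 2"
  shows "AE y in surface_measure \<Omega>. y \<noteq> x"
proof (cases "x \<in> frontier \<Omega>")
  case True
  have "emeasure (surface_measure \<Omega>) {x} \<le> hausdorff_outer (DIM('a) - 1) {x}"
    using True by (intro emeasure_surface_measure_le) auto
  then have "emeasure (surface_measure \<Omega>) {x} = 0"
    using assms by (simp add: hausdorff_outer_singleton)
  moreover have "{x} \<in> sets (surface_measure \<Omega>)"
    using True by (auto simp: sets_surface_measure sets_restrict_space image_iff intro!: bexI[of _ "{x}"])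
  ultimately have "{x} \<in> null_sets (surface_measure \<Omega>)" by blast
  from AE_not_in[OF this] show ?thesis by simp
next
  case False
  then show ?thesis by (intro AE_I2) (auto simp: space_surface_measure)
qed

text \<open>Each boundary point has a chart in which the Hausdorff bound for Lipschitz graphs
  applies, and compactness leaves finitely many charts. Finiteness makes L2 densities integrable and
  parameter integrals measurable.\<close>

lemma finite_surface_measure:
  fixes \<Omega> :: "'a::euclidean_space set"
  assumes dim: "DIM('a) \<ge> 2" and \<Omega>: "open \<Omega>" "bounded \<Omega>" "\<alpha> > 0" "C1_holder_boundary \<alpha> \<Omega>"
  shows "finite_measure (surface_measure \<Omega>)"
proof
  have "\<exists>r>0. emeasure (surface_measure \<Omega>) (frontier \<Omega> \<inter> ball p r) < \<infinity>" if p: "p \<in> frontier \<Omega>" for p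
  proof -
    obtain e r g L where "boundary_graph \<Omega> p e r g L"
      using boundary_graph_exists[OF \<Omega>(3,4) p \<Omega>(1)] .
    then interpret boundary_graph \<Omega> p e r g L .
    have "hausdorff_outer (DIM('a) - 1) (frontier \<Omega> \<inter> ball p r) < \<infinity>"
      using L by (intro hausdorff_outer_lipschitz_graph_finite[OF dim e, where L = "1 + L"])
        (auto intro!: graph_bilipschitz bounded_Int)
    then show ?thesis
      using r emeasure_surface_measure_le[of "frontier \<Omega> \<inter> ball p r" \<Omega>] by (auto intro: le_less_trans)
  qed
  then obtain r where r: "\<And>p. p \<in> frontier \<Omega> \<Longrightarrow> r p > 0"
    "\<And>p. p \<in> frontier \<Omega> \<Longrightarrow> emeasure (surface_measure \<Omega>) (frontier \<Omega> \<inter> ball p (r p)) < \<infinity>"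
    by metis
  have "compact (frontier \<Omega>)" using \<Omega>(2) by (rule compact_frontier_bounded)
  moreover have "frontier \<Omega> \<subseteq> (\<Union>p\<in>frontier \<Omega>. ball p (r p))" using r(1) by force
  ultimately obtain C where C: "C \<subseteq> frontier \<Omega>" "finite C" "frontier \<Omega> \<subseteq> (\<Union>p\<in>C. ball p (r p))"
    using compactE_image[of "frontier \<Omega>" "frontier \<Omega>" "\<lambda>p. ball p (r p)"] by blast
  have "frontier \<Omega> = (\<Union>p\<in>C. frontier \<Omega> \<inter> ball p (r p))" using C by auto
  then have "emeasure (surface_measure \<Omega>) (frontier \<Omega>) =
      emeasure (surface_measure \<Omega>) (\<Union>p\<in>C. frontier \<Omega> \<inter> ball p (r p))" by simp
  also have "\<dots> \<le> (\<Sum>p\<in>C. emeasure (surface_measure \<Omega>) (frontier \<Omega> \<inter> ball p (r p)))"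
    using C by (intro emeasure_subadditive_finite) (auto simp: sets_surface_measure sets_restrict_space)
  also have "\<dots> < \<infinity>" using C(1,2) r(2) by (auto simp: less_top)
  finally show "emeasure (surface_measure \<Omega>) (space (surface_measure \<Omega>)) \<noteq> \<infinity>"
    by (simp add: space_surface_measure)
qed

subsection \<open>Functionals with square-integrable density\<close>

lemma measurable_id_surface_measure: "(\<lambda>x. x) \<in> measurable (surface_measure \<Omega>) borel"
  by (subst measurable_cong_sets[OF sets_surface_measure refl]) (simp add: measurable_restrict_space1)

lemma L2_bd_integrable_mult:
  assumes "f \<in> L2_bd \<Omega>" "g \<in> L2_bd \<Omega>"
  shows "integrable (surface_measure \<Omega>) (\<lambda>x. f x * g x)"
proof -
  have [measurable]: "f \<in> borel_measurable (surface_measure \<Omega>)" "g \<in> borel_measurable (surface_measure \<Omega>)"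
    using assms by (auto simp: L2_bd_def)
  have "integrable (surface_measure \<Omega>) (\<lambda>x. (f x)\<^sup>2)" "integrable (surface_measure \<Omega>) (\<lambda>x. (g x)\<^sup>2)"
    using assms by (auto intro!: integrableI_bounded simp: L2_bd_def)
  then have "integrable (surface_measure \<Omega>) (\<lambda>x. (f x)\<^sup>2 + (g x)\<^sup>2)"
    by (rule Bochner_Integration.integrable_add)
  then show ?thesis
  proof (rule Bochner_Integration.integrable_bound)
    have "norm (f x * g x) \<le> norm ((f x)\<^sup>2 + (g x)\<^sup>2)" for x
    proof -
      have "2 * (\<bar>f x\<bar> * \<bar>g x\<bar>) \<le> (f x)\<^sup>2 + (g x)\<^sup>2"
        using sum_squares_bound[of "\<bar>f x\<bar>" "\<bar>g x\<bar>"] by simp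
      moreover have "0 \<le> \<bar>f x\<bar> * \<bar>g x\<bar>" by simp
      ultimately have "\<bar>f x\<bar> * \<bar>g x\<bar> \<le> (f x)\<^sup>2 + (g x)\<^sup>2" by linarith
      then show ?thesis by (simp add: abs_mult)
    qed
    then show "AE x in surface_measure \<Omega>. norm (f x * g x) \<le> norm ((f x)\<^sup>2 + (g x)\<^sup>2)" by simp
  qed measurable
qed

lemma L2_bd_integrable:
  assumes "finite_measure (surface_measure \<Omega>)" "f \<in> L2_bd \<Omega>"
  shows "integrable (surface_measure \<Omega>) f"
proof -
  interpret finite_measure "surface_measure \<Omega>" by fact
  have "(\<lambda>_. 1) \<in> L2_bd \<Omega>" by (simp add: L2_bd_def emeasure_finite less_top[symmetric])
  from L2_bd_integrable_mult[OF this assms(2)] show ?thesis by simp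
qed

lemma H12_subset_L2_bd: "H12 \<Omega> \<subseteq> L2_bd \<Omega>"
  by (auto simp: H12_def H12_norm_sq_def L2_bd_def)

text \<open>From (p + q)^2 <= 2 p^2 + 2 q^2. The weight is 1 for the L2 part of the Sobolev norm and
  |x - y|^d for the double integral; on the diagonal it is 0 and the quotient is 0 by
  convention.\<close>

lemma nn_integral_square_lincomb_le:
  fixes f g :: "'b \<Rightarrow> real"
  assumes [measurable]: "f \<in> borel_measurable M" "g \<in> borel_measurable M" "w \<in> borel_measurable M"
    and w: "\<And>x. w x \<ge> 0"
  shows "(\<integral>\<^sup>+x. ennreal ((a * f x + b * g x)\<^sup>2 / w x) \<partial>M) \<le>
    ennreal (2 * a\<^sup>2) * (\<integral>\<^sup>+x. ennreal ((f x)\<^sup>2 / w x) \<partial>M) + ennreal (2 * b\<^sup>2) * (\<integral>\<^sup>+x. ennreal ((g x)\<^sup>2 / w x) \<partial>M)"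
proof -
  have "(a * f x + b * g x)\<^sup>2 / w x \<le> 2 * a\<^sup>2 * ((f x)\<^sup>2 / w x) + 2 * b\<^sup>2 * ((g x)\<^sup>2 / w x)" for x
  proof -
    have "(a * f x + b * g x)\<^sup>2 \<le> 2 * (a * f x)\<^sup>2 + 2 * (b * g x)\<^sup>2"
      using sum_squares_bound[of "a * f x" "b * g x"] by (simp add: power2_sum)
    then show ?thesis
      using divide_right_mono[OF _ w[of x]] by (fastforce simp: power_mult_distrib add_divide_distrib)
  qed
  then have "(\<integral>\<^sup>+x. ennreal ((a * f x + b * g x)\<^sup>2 / w x) \<partial>M) \<le>
      (\<integral>\<^sup>+x. ennreal (2 * a\<^sup>2) * ennreal ((f x)\<^sup>2 / w x) + ennreal (2 * b\<^sup>2) * ennreal ((g x)\<^sup>2 / w x) \<partial>M)"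
    using w by (intro nn_integral_mono) (simp flip: ennreal_mult ennreal_plus add: ennreal_leI)
  then show ?thesis by (simp add: nn_integral_add nn_integral_cmult)
qed

text \<open>\<open>density_functional\<close> is cut off to 0 outside \<open>H12 \<Omega>\<close>,
  so its linearity depends on this closure property.\<close>

lemma H12_lincomb:
  fixes \<Omega> :: "'a::euclidean_space set"
  assumes "finite_measure (surface_measure \<Omega>)" and f: "f \<in> H12 \<Omega>" and g: "g \<in> H12 \<Omega>"
  shows "(\<lambda>x. a * f x + b * g x) \<in> H12 \<Omega>"
proof -
  let ?\<sigma> = "surface_measure \<Omega>"
  interpret finite_measure ?\<sigma> by fact
  have [measurable]: "f \<in> borel_measurable ?\<sigma>" "g \<in> borel_measurable ?\<sigma>"
    using f g by (auto simp: H12_def)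
  note [measurable] = measurable_id_surface_measure[of \<Omega>]
  define I where "I f x = (\<integral>\<^sup>+y. ennreal ((f x - f y)\<^sup>2 / norm (x - y) ^ DIM('a)) \<partial>?\<sigma>)" for f :: "'a \<Rightarrow> real" and x :: 'a
  have I [measurable]: "I f \<in> borel_measurable ?\<sigma>" if [measurable]: "f \<in> borel_measurable ?\<sigma>" for f
  proof -
    have "fst \<in> borel_measurable (?\<sigma> \<Otimes>\<^sub>M ?\<sigma>)" "snd \<in> borel_measurable (?\<sigma> \<Otimes>\<^sub>M ?\<sigma>)"
      using measurable_compose[OF measurable_fst measurable_id_surface_measure]
        measurable_compose[OF measurable_snd measurable_id_surface_measure] by auto
    then have [measurable]: "(\<lambda>p. norm (fst p - snd p)) \<in> borel_measurable (?\<sigma> \<Otimes>\<^sub>M ?\<sigma>)"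
      by (rule measurable_compose[OF borel_measurable_diff borel_measurable_norm])
    have "(\<lambda>p. ennreal ((f (fst p) - f (snd p))\<^sup>2 / norm (fst p - snd p) ^ DIM('a))) \<in> borel_measurable (?\<sigma> \<Otimes>\<^sub>M ?\<sigma>)"
      by measurable
    then show ?thesis
      unfolding I_def by (intro borel_measurable_nn_integral) (simp add: case_prod_unfold)
  qed
  have N: "H12_norm_sq \<Omega> f = (\<integral>\<^sup>+x. ennreal ((f x)\<^sup>2) \<partial>?\<sigma>) + (\<integral>\<^sup>+x. I f x \<partial>?\<sigma>)" for f
    by (simp add: H12_norm_sq_def I_def)
  let ?h = "\<lambda>x. a * f x + b * g x"
  have "I ?h x \<le> ennreal (2 * a\<^sup>2) * I f x + ennreal (2 * b\<^sup>2) * I g x" for x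
  proof -
    have "?h x - ?h y = a * (f x - f y) + b * (g x - g y)" for y by (simp add: algebra_simps)
    then show ?thesis
      unfolding I_def by (simp only:) (rule nn_integral_square_lincomb_le; measurable; simp)
  qed
  then have "(\<integral>\<^sup>+x. I ?h x \<partial>?\<sigma>) \<le> (\<integral>\<^sup>+x. ennreal (2 * a\<^sup>2) * I f x + ennreal (2 * b\<^sup>2) * I g x \<partial>?\<sigma>)"
    by (intro nn_integral_mono)
  also have "\<dots> = ennreal (2 * a\<^sup>2) * (\<integral>\<^sup>+x. I f x \<partial>?\<sigma>) + ennreal (2 * b\<^sup>2) * (\<integral>\<^sup>+x. I g x \<partial>?\<sigma>)"
    by (simp add: nn_integral_add nn_integral_cmult)
  also have "\<dots> < \<infinity>"
    using f g by (auto simp: H12_def N ennreal_mult_less_top)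
  finally have "(\<integral>\<^sup>+x. I ?h x \<partial>?\<sigma>) < \<infinity>" .
  moreover have "(\<integral>\<^sup>+x. ennreal ((?h x)\<^sup>2) \<partial>?\<sigma>) < \<infinity>"
  proof -
    have "(\<integral>\<^sup>+x. ennreal ((?h x)\<^sup>2) \<partial>?\<sigma>) \<le>
        ennreal (2 * a\<^sup>2) * (\<integral>\<^sup>+x. ennreal ((f x)\<^sup>2) \<partial>?\<sigma>) + ennreal (2 * b\<^sup>2) * (\<integral>\<^sup>+x. ennreal ((g x)\<^sup>2) \<partial>?\<sigma>)"
      using nn_integral_square_lincomb_le[of f ?\<sigma> g "\<lambda>_. 1" a b] by simp
    also have "\<dots> < \<infinity>"
      using f g by (auto simp: H12_def N ennreal_mult_less_top)
    finally show ?thesis .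
  qed
  ultimately show ?thesis by (simp add: H12_def N)
qed

text \<open>Boundedness is the Cauchy-Schwarz inequality against the L2 part of the Sobolev norm,
  carried out for extended non-negative integrals and then transferred to the reals by
  finiteness.\<close>

lemma density_functional_in_Hm12:
  fixes \<Omega> :: "'a::euclidean_space set"
  assumes fin: "finite_measure (surface_measure \<Omega>)" and \<psi>: "\<psi> \<in> L2_bd \<Omega>"
  shows "density_functional \<Omega> \<psi> \<in> Hm12 \<Omega>"
proof -
  let ?\<sigma> = "surface_measure \<Omega>"
  have [measurable]: "\<psi> \<in> borel_measurable ?\<sigma>" using \<psi> by (simp add: L2_bd_def)
  have int: "integrable ?\<sigma> (\<lambda>x. \<psi> x * f x)" if "f \<in> H12 \<Omega>" for f
    using L2_bd_integrable_mult[OF \<psi>] H12_subset_L2_bd that by blast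
  have lin: "density_functional \<Omega> \<psi> (\<lambda>x. a * f x + b * g x) =
      a * density_functional \<Omega> \<psi> f + b * density_functional \<Omega> \<psi> g"
    if "f \<in> H12 \<Omega>" "g \<in> H12 \<Omega>" for f g a b
  proof -
    have "(\<integral>x. \<psi> x * (a * f x + b * g x) \<partial>?\<sigma>) = (\<integral>x. a * (\<psi> x * f x) + b * (\<psi> x * g x) \<partial>?\<sigma>)"
      by (simp add: algebra_simps)
    also have "\<dots> = a * (\<integral>x. \<psi> x * f x \<partial>?\<sigma>) + b * (\<integral>x. \<psi> x * g x \<partial>?\<sigma>)"
      using int[OF that(1)] int[OF that(2)] by (subst Bochner_Integration.integral_add) auto
    finally show ?thesis
      using that H12_lincomb[OF fin that] by (simp add: density_functional_def)
  qed
  define p where "p = (\<integral>\<^sup>+x. ennreal ((\<psi> x)\<^sup>2) \<partial>?\<sigma>)"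
  have p: "p < \<infinity>" using \<psi> by (simp add: p_def L2_bd_def)
  have bound: "\<bar>density_functional \<Omega> \<psi> f\<bar> \<le> sqrt (enn2real p) * H12_norm \<Omega> f" if f: "f \<in> H12 \<Omega>" for f
  proof -
    have [measurable]: "f \<in> borel_measurable ?\<sigma>" using f by (simp add: H12_def)
    have N: "H12_norm_sq \<Omega> f < \<infinity>" using f by (simp add: H12_def)
    define A where "A = (\<integral>x. \<bar>\<psi> x * f x\<bar> \<partial>?\<sigma>)"
    have A0: "A \<ge> 0" by (simp add: A_def)
    have "ennreal (A\<^sup>2) = (\<integral>\<^sup>+x. ennreal \<bar>\<psi> x\<bar> * ennreal \<bar>f x\<bar> \<partial>?\<sigma>)\<^sup>2"
    proof -
      have "ennreal A = (\<integral>\<^sup>+x. ennreal \<bar>\<psi> x * f x\<bar> \<partial>?\<sigma>)"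
        unfolding A_def by (rule nn_integral_eq_integral[symmetric]) (auto intro: integrable_abs int[OF f])
      then show ?thesis by (simp add: ennreal_power[OF A0, symmetric] abs_mult ennreal_mult)
    qed
    also have "\<dots> \<le> (\<integral>\<^sup>+x. (ennreal \<bar>\<psi> x\<bar>)\<^sup>2 \<partial>?\<sigma>) * (\<integral>\<^sup>+x. (ennreal \<bar>f x\<bar>)\<^sup>2 \<partial>?\<sigma>)"
      by (rule Cauchy_Schwarz_nn_integral) measurable
    also have "\<dots> \<le> p * H12_norm_sq \<Omega> f"
      unfolding p_def H12_norm_sq_def by (intro mult_mono) (auto simp: ennreal_power)
    also have "\<dots> = ennreal (enn2real p * enn2real (H12_norm_sq \<Omega> f))"
      using p N by (simp add: ennreal_mult)
    finally have "A\<^sup>2 \<le> enn2real p * enn2real (H12_norm_sq \<Omega> f)" by simp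
    then have "A \<le> sqrt (enn2real p * enn2real (H12_norm_sq \<Omega> f))" by (rule real_le_rsqrt)
    moreover have "\<bar>density_functional \<Omega> \<psi> f\<bar> \<le> A"
      using f integral_norm_bound[of ?\<sigma> "\<lambda>x. \<psi> x * f x"] by (simp add: density_functional_def A_def)
    ultimately show ?thesis by (simp add: H12_norm_def real_sqrt_mult)
  qed
  show ?thesis
    unfolding Hm12_def
  proof (intro CollectI conjI)
    show "\<exists>C. \<forall>f\<in>H12 \<Omega>. \<bar>density_functional \<Omega> \<psi> f\<bar> \<le> C * H12_norm \<Omega> f"
      using bound by blast
    show "\<forall>f. f \<notin> H12 \<Omega> \<longrightarrow> density_functional \<Omega> \<psi> f = 0"
      by (simp add: density_functional_def)
  qed (use lin in blast)
qed

subsection \<open>The single layer potential in the exterior and on the boundary\<close>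

lemma measurable_kernel_surface_measure:
  assumes "k \<in> borel_measurable borel"
  shows "(\<lambda>y. k (z - y)) \<in> borel_measurable (surface_measure \<Omega>)"
  by (rule measurable_compose[OF measurable_id_surface_measure]) (use assms in measurable)

lemma single_layer_integral_line_const:
  fixes z v :: "'a::euclidean_space"
  assumes "DIM('a) \<ge> 2" "bounded \<Omega>" "integrable (surface_measure \<Omega>) \<psi>"
    and zero: "\<And>s. s \<ge> 0 \<Longrightarrow> (\<integral>y. dipole_kernel v (z + s *\<^sub>R v - y) * \<psi> y \<partial>surface_measure \<Omega>) = 0"
    and ext: "\<And>s. s \<ge> 0 \<Longrightarrow> z + s *\<^sub>R v \<notin> frontier \<Omega>" and "t \<ge> 0"
  shows "single_layer_integral \<Omega> \<psi> (z + t *\<^sub>R v) = single_layer_integral \<Omega> \<psi> z"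
proof -
  have "\<exists>c. \<forall>s\<in>{0..}. single_layer_integral \<Omega> \<psi> (z + s *\<^sub>R v) = c"
  proof (rule has_field_derivative_zero_constant)
    fix s :: real assume s: "s \<in> {0..}"
    have "((\<lambda>h. single_layer_integral \<Omega> \<psi> ((z + s *\<^sub>R v) + h *\<^sub>R v)) has_real_derivative 0) (at 0)"
      using single_layer_line_derivative[OF assms(1) compact_frontier_bounded[OF assms(2)]
          sets_surface_measure assms(3) ext[of s], of v] zero[of s] s
      by (simp add: single_layer_integral_def)
    \<comment> \<open>The derivative is known at parameter 0 from a moving base point; a shift turns
      it into the derivative at \<open>s\<close> along one fixed ray.\<close>
    then have "((\<lambda>h. single_layer_integral \<Omega> \<psi> (z + (h + s) *\<^sub>R v)) has_real_derivative 0) (at 0)"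
      by (simp add: algebra_simps)
    then have "((\<lambda>s. single_layer_integral \<Omega> \<psi> (z + s *\<^sub>R v)) has_real_derivative 0) (at (0 + s))"
      by (subst DERIV_shift) (simp add: add.commute)
    then show "((\<lambda>s. single_layer_integral \<Omega> \<psi> (z + s *\<^sub>R v)) has_real_derivative 0) (at s within {0..})"
      using DERIV_subset by fastforce
  qed simp
  then obtain c where c: "\<And>s. s \<ge> 0 \<Longrightarrow> single_layer_integral \<Omega> \<psi> (z + s *\<^sub>R v) = c" by auto
  show ?thesis using c[of t] c[of 0] \<open>t \<ge> 0\<close> by simp
qed

section \<open>Behaviour of the potential far out on a ray\<close>

lemma far_point_estimate:
  fixes y z v :: "'a::real_normed_vector"
  assumes "norm y \<le> R" "2 * (norm z + R) \<le> s * norm v" "s \<ge> 0"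
  shows "s * norm v / 2 \<le> norm (z + s *\<^sub>R v - y)" "norm (z + s *\<^sub>R v - y) \<le> 3 / 2 * (s * norm v)"
proof -
  \<comment> \<open>The perturbation \<open>z - y\<close> is at most half as long as
    \<open>s *\<^sub>R v\<close>, which gives the factors 1/2 and 3/2.\<close>
  have "norm (z - y) \<le> norm z + R" using norm_triangle_ineq4[of z y] assms(1) by linarith
  moreover have "norm (s *\<^sub>R v) \<le> norm (z + s *\<^sub>R v - y) + norm (z - y)"
    using norm_triangle_ineq4[of "z + s *\<^sub>R v - y" "z - y"] by simp
  moreover have "norm (z + s *\<^sub>R v - y) \<le> norm (s *\<^sub>R v) + norm (z - y)"
    using norm_triangle_ineq[of "s *\<^sub>R v" "z - y"] by (simp add: algebra_simps)
  ultimately show "s * norm v / 2 \<le> norm (z + s *\<^sub>R v - y)" "norm (z + s *\<^sub>R v - y) \<le> 3 / 2 * (s * norm v)"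
    using assms(2,3) by auto
qed

lemma single_layer_integral_decay:
  fixes z v :: "'a::euclidean_space"
  assumes dim: "DIM('a) \<ge> 3" and "bounded \<Omega>" and \<psi>: "integrable (surface_measure \<Omega>) \<psi>" and v: "v \<noteq> 0"
  shows "(\<lambda>n. single_layer_integral \<Omega> \<psi> (z + real n *\<^sub>R v)) \<longlonglongrightarrow> 0"
proof -
  let ?\<sigma> = "surface_measure \<Omega>"
  obtain R where R: "\<And>y. y \<in> frontier \<Omega> \<Longrightarrow> norm y \<le> R"
    using compact_imp_bounded[OF compact_frontier_bounded[OF assms(2)]] bounded_iff by blast
  define a where "a = 2 - real DIM('a)"
  have a: "a < 0" using dim by (simp add: a_def)
  define k where "k = - 1 / (real DIM('a) * (real DIM('a) - 2) * unit_ball_vol (real DIM('a)))"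
  have \<Gamma>: "fundamental_solution x = k * norm x powr a" for x :: 'a
    using dim by (simp add: fundamental_solution_def k_def a_def)
  \<comment> \<open>From index \<open>N\<close> on, the far point estimate applies.
    \<open>N \<ge> 1\<close> also keeps the distances above \<open>norm v / 2\<close>, the origin of
    the constant in the dominating function.\<close>
  obtain N where N: "N \<ge> 1" "2 * (norm z + R) \<le> real N * norm v"
  proof -
    obtain N :: nat where "2 * (norm z + R) / norm v \<le> real N" using real_arch_simple by blast
    then have "2 * (norm z + R) \<le> real N * norm v" using v by (simp add: pos_divide_le_eq)
    also have "\<dots> \<le> real (N + 1) * norm v" by (intro mult_right_mono) auto
    finally have "2 * (norm z + R) \<le> real (N + 1) * norm v" .
    then show thesis by (intro that[of "N + 1"]) auto
  qed
  have est: "norm v / 2 * real (n + N) \<le> norm (z + real (n + N) *\<^sub>R v - y)" if "y \<in> frontier \<Omega>" for n y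
  proof -
    have "real N * norm v \<le> real (n + N) * norm v" by (intro mult_right_mono) auto
    then show ?thesis
      using far_point_estimate(1)[OF R[OF that], of z "real (n + N)" v] N(2) by (simp add: mult.commute)
  qed
  have "(\<lambda>n. \<integral>y. fundamental_solution (z + real (n + N) *\<^sub>R v - y) * \<psi> y \<partial>?\<sigma>) \<longlonglongrightarrow> (\<integral>y. 0 \<partial>?\<sigma>)"
  proof (rule integral_dominated_convergence)
    show "(\<lambda>y. fundamental_solution (z + real (n + N) *\<^sub>R v - y) * \<psi> y) \<in> borel_measurable ?\<sigma>" for n
      by (intro borel_measurable_times measurable_kernel_surface_measure fundamental_solution_measurable
          borel_measurable_integrable[OF \<psi>])
    show "integrable ?\<sigma> (\<lambda>y. \<bar>k\<bar> * (norm v / 2) powr a * \<bar>\<psi> y\<bar>)"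
      by (intro integrable_mult_right integrable_abs \<psi>)
    show "AE y in ?\<sigma>. (\<lambda>n. fundamental_solution (z + real (n + N) *\<^sub>R v - y) * \<psi> y) \<longlonglongrightarrow> 0"
    proof (rule AE_I2)
      fix y assume y: "y \<in> space ?\<sigma>"
      have "filterlim (\<lambda>n. norm v / 2 * real n) at_top sequentially"
        using v by (intro filterlim_tendsto_pos_mult_at_top[OF tendsto_const _ filterlim_real_sequentially]) simp
      then have "filterlim (\<lambda>n. norm v / 2 * real (n + N)) at_top sequentially"
        by (rule filterlim_compose[OF _ filterlim_add_const_nat_at_top])
      then have "filterlim (\<lambda>n. norm (z + real (n + N) *\<^sub>R v - y)) at_top sequentially"
      proof (rule filterlim_at_top_mono[OF _ always_eventually], intro allI)
        show "norm v / 2 * real (n + N) \<le> norm (z + real (n + N) *\<^sub>R v - y)" for n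
          using est y by (simp only: space_surface_measure)
      qed
      then have "(\<lambda>n. norm (z + real (n + N) *\<^sub>R v - y) powr a) \<longlonglongrightarrow> 0"
        by (rule tendsto_neg_powr[OF a])
      then show "(\<lambda>n. fundamental_solution (z + real (n + N) *\<^sub>R v - y) * \<psi> y) \<longlonglongrightarrow> 0"
        unfolding \<Gamma> by (intro tendsto_mult_left_zero tendsto_mult_right_zero)
    qed
    show "AE y in ?\<sigma>. norm (fundamental_solution (z + real (n + N) *\<^sub>R v - y) * \<psi> y)
        \<le> \<bar>k\<bar> * (norm v / 2) powr a * \<bar>\<psi> y\<bar>" for n
    proof (rule AE_I2)
      fix y assume y: "y \<in> space ?\<sigma>"
      have "norm v / 2 * 1 \<le> norm v / 2 * real (n + N)" using N(1) by (intro mult_left_mono) auto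
      then have "norm v / 2 \<le> norm (z + real (n + N) *\<^sub>R v - y)"
        using est[of y n] y by (simp add: space_surface_measure)
      then have "norm (z + real (n + N) *\<^sub>R v - y) powr a \<le> (norm v / 2) powr a"
        using v a by (intro powr_mono2') auto
      then have "\<bar>k\<bar> * norm (z + real (n + N) *\<^sub>R v - y) powr a * \<bar>\<psi> y\<bar> \<le> \<bar>k\<bar> * (norm v / 2) powr a * \<bar>\<psi> y\<bar>"
        by (intro mult_right_mono mult_left_mono) auto
      then show "norm (fundamental_solution (z + real (n + N) *\<^sub>R v - y) * \<psi> y) \<le> \<bar>k\<bar> * (norm v / 2) powr a * \<bar>\<psi> y\<bar>"
        unfolding \<Gamma> by (simp add: abs_mult)
    qed
  qed simp
  then have "(\<lambda>n. single_layer_integral \<Omega> \<psi> (z + real (n + N) *\<^sub>R v)) \<longlonglongrightarrow> 0"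
    by (simp add: single_layer_integral_def)
  then show ?thesis by (rule LIMSEQ_offset)
qed

text \<open>Subtracting the logarithm of n |v| under the integral leaves the logarithm of the ratio
  \<open>q\<close>. This ratio lies between 1/2 and 3/2 and tends to 1, so dominated convergence
  applies with |\<psi>|.\<close>

lemma single_layer_integral_log_growth:
  fixes z v :: "'a::euclidean_space"
  assumes dim: "DIM('a) = 2" and "bounded \<Omega>" and \<psi>: "integrable (surface_measure \<Omega>) \<psi>" and v: "v \<noteq> 0"
  shows "(\<lambda>n. single_layer_integral \<Omega> \<psi> (z + real n *\<^sub>R v) -
      ln (real n * norm v) / (2 * pi) * (\<integral>y. \<psi> y \<partial>surface_measure \<Omega>)) \<longlonglongrightarrow> 0"
proof -
  let ?\<sigma> = "surface_measure \<Omega>"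
  obtain R where R: "\<And>y. y \<in> frontier \<Omega> \<Longrightarrow> norm y \<le> R"
    using compact_imp_bounded[OF compact_frontier_bounded[OF assms(2)]] bounded_iff by blast
  have \<Gamma>: "fundamental_solution x = ln (norm x) / (2 * pi)" for x :: 'a
    using dim by (simp add: fundamental_solution_def)
  obtain N where N: "N \<ge> 1" "2 * (norm z + R) \<le> real N * norm v"
  proof -
    obtain N :: nat where "2 * (norm z + R) / norm v \<le> real N" using real_arch_simple by blast
    then have "2 * (norm z + R) \<le> real N * norm v" using v by (simp add: pos_divide_le_eq)
    also have "\<dots> \<le> real (N + 1) * norm v" by (intro mult_right_mono) auto
    finally have "2 * (norm z + R) \<le> real (N + 1) * norm v" .
    then show thesis by (intro that[of "N + 1"]) auto
  qed
  define q where "q n y = norm (z + real (n + N) *\<^sub>R v - y) / (real (n + N) * norm v)" for n y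
  have pos: "real (n + N) * norm v > 0" for n using N(1) v by simp
  have q_bounds: "1 / 2 \<le> q n y" "q n y \<le> 3 / 2" if "y \<in> frontier \<Omega>" for n y
  proof -
    have "real N * norm v \<le> real (n + N) * norm v" by (intro mult_right_mono) auto
    then have *: "2 * (norm z + R) \<le> real (n + N) * norm v" using N(2) by linarith
    show "1 / 2 \<le> q n y" "q n y \<le> 3 / 2"
      using far_point_estimate[OF R[OF that] *] pos[of n] unfolding q_def
      by (simp_all add: pos_le_divide_eq pos_divide_le_eq)
  qed
  have diff: "fundamental_solution (z + real (n + N) *\<^sub>R v - y) - ln (real (n + N) * norm v) / (2 * pi) = ln (q n y) / (2 * pi)"
    if "y \<in> frontier \<Omega>" for n y
  proof -
    have "norm (z + real (n + N) *\<^sub>R v - y) > 0"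
      using q_bounds(1)[OF that, of n] by (auto simp: q_def)
    then show ?thesis
      unfolding \<Gamma> q_def by (simp only: ln_divide_pos[OF _ pos[of n]] diff_divide_distrib)
  qed
  have int: "integrable ?\<sigma> (\<lambda>y. fundamental_solution (z + real (n + N) *\<^sub>R v - y) * \<psi> y - ln (real (n + N) * norm v) / (2 * pi) * \<psi> y)"
    and bound: "AE y in ?\<sigma>. norm (fundamental_solution (z + real (n + N) *\<^sub>R v - y) * \<psi> y - ln (real (n + N) * norm v) / (2 * pi) * \<psi> y) \<le> \<bar>\<psi> y\<bar>"
    and meas: "(\<lambda>y. fundamental_solution (z + real (n + N) *\<^sub>R v - y) * \<psi> y - ln (real (n + N) * norm v) / (2 * pi) * \<psi> y) \<in> borel_measurable ?\<sigma>"
    for n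
  proof -
    show bound: "AE y in ?\<sigma>. norm (fundamental_solution (z + real (n + N) *\<^sub>R v - y) * \<psi> y - ln (real (n + N) * norm v) / (2 * pi) * \<psi> y) \<le> \<bar>\<psi> y\<bar>"
    proof (rule AE_I2)
      fix y assume "y \<in> space ?\<sigma>"
      then have y: "y \<in> frontier \<Omega>" by (simp add: space_surface_measure)
      have "ln (q n y) \<le> 1" using q_bounds[OF y, of n] ln_le_minus_one[of "q n y"] by linarith
      \<comment> \<open>The lower bound on the logarithm is the inequality ln t <= t - 1 at the
        reciprocal, which is at most 2.\<close>
      moreover have "- ln (q n y) \<le> 1"
      proof -
        have "inverse (q n y) \<le> 2" using q_bounds(1)[OF y, of n] le_imp_inverse_le[of "1 / 2" "q n y"] by simp
        then show ?thesis
          using ln_le_minus_one[of "inverse (q n y)"] q_bounds(1)[OF y, of n] by (simp add: ln_inverse)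
      qed
      ultimately have "\<bar>ln (q n y)\<bar> \<le> 1" by linarith
      then have "\<bar>ln (q n y) / (2 * pi)\<bar> \<le> 1"
        using pi_gt3 by (simp add: abs_divide pos_divide_le_eq)
      then have "\<bar>ln (q n y) / (2 * pi)\<bar> * \<bar>\<psi> y\<bar> \<le> 1 * \<bar>\<psi> y\<bar>" by (intro mult_right_mono) auto
      then show "norm (fundamental_solution (z + real (n + N) *\<^sub>R v - y) * \<psi> y - ln (real (n + N) * norm v) / (2 * pi) * \<psi> y) \<le> \<bar>\<psi> y\<bar>"
        unfolding left_diff_distrib[symmetric] diff[OF y] by (simp add: abs_mult)
    qed
    show meas: "(\<lambda>y. fundamental_solution (z + real (n + N) *\<^sub>R v - y) * \<psi> y - ln (real (n + N) * norm v) / (2 * pi) * \<psi> y) \<in> borel_measurable ?\<sigma>"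
      by (intro borel_measurable_diff borel_measurable_times measurable_kernel_surface_measure
          fundamental_solution_measurable borel_measurable_integrable[OF \<psi>] borel_measurable_const)
    show "integrable ?\<sigma> (\<lambda>y. fundamental_solution (z + real (n + N) *\<^sub>R v - y) * \<psi> y - ln (real (n + N) * norm v) / (2 * pi) * \<psi> y)"
      by (rule Bochner_Integration.integrable_bound[OF integrable_abs[OF \<psi>] meas]) (use bound in simp)
  qed
  have "(\<lambda>n. \<integral>y. fundamental_solution (z + real (n + N) *\<^sub>R v - y) * \<psi> y - ln (real (n + N) * norm v) / (2 * pi) * \<psi> y \<partial>?\<sigma>)
      \<longlonglongrightarrow> (\<integral>y. 0 \<partial>?\<sigma>)"
  proof (rule integral_dominated_convergence[OF _ meas integrable_abs[OF \<psi>] _ bound])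
    show "AE y in ?\<sigma>. (\<lambda>n. fundamental_solution (z + real (n + N) *\<^sub>R v - y) * \<psi> y - ln (real (n + N) * norm v) / (2 * pi) * \<psi> y) \<longlonglongrightarrow> 0"
    proof (rule AE_I2)
      fix y assume "y \<in> space ?\<sigma>"
      then have y: "y \<in> frontier \<Omega>" by (simp add: space_surface_measure)
      have "(\<lambda>n. norm (inverse (real n) *\<^sub>R (z - y) + v) / norm v) \<longlonglongrightarrow> norm (0 *\<^sub>R (z - y) + v) / norm v"
        using v by (intro tendsto_intros lim_inverse_n) auto
      then have lim: "(\<lambda>n. norm (inverse (real (n + N)) *\<^sub>R (z - y) + v) / norm v) \<longlonglongrightarrow> 1"
        using v LIMSEQ_ignore_initial_segment by fastforce
      have "q n y = norm (inverse (real (n + N)) *\<^sub>R (z - y) + v) / norm v" for n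
      proof -
        have "z + real (n + N) *\<^sub>R v - y = real (n + N) *\<^sub>R (inverse (real (n + N)) *\<^sub>R (z - y) + v)"
          using N(1) by (simp add: scaleR_right_distrib del: of_nat_add)
        then have "norm (z + real (n + N) *\<^sub>R v - y) = real (n + N) * norm (inverse (real (n + N)) *\<^sub>R (z - y) + v)"
          by (metis abs_of_nat norm_scaleR)
        then show ?thesis using N(1) by (simp add: q_def del: of_nat_add)
      qed
      then have "(\<lambda>n. q n y) \<longlonglongrightarrow> 1" using lim by simp
      then have "(\<lambda>n. ln (q n y) / (2 * pi) * \<psi> y) \<longlonglongrightarrow> ln 1 / (2 * pi) * \<psi> y"
        by (intro tendsto_intros) auto
      then show "(\<lambda>n. fundamental_solution (z + real (n + N) *\<^sub>R v - y) * \<psi> y - ln (real (n + N) * norm v) / (2 * pi) * \<psi> y) \<longlonglongrightarrow> 0"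
        unfolding left_diff_distrib[symmetric] diff[OF y] by simp
    qed
  qed simp
  moreover have "(\<integral>y. fundamental_solution (z + real (n + N) *\<^sub>R v - y) * \<psi> y - ln (real (n + N) * norm v) / (2 * pi) * \<psi> y \<partial>?\<sigma>)
      = single_layer_integral \<Omega> \<psi> (z + real (n + N) *\<^sub>R v) - ln (real (n + N) * norm v) / (2 * pi) * (\<integral>y. \<psi> y \<partial>?\<sigma>)" for n
  proof -
    \<comment> \<open>Integrability was shown for the difference; adding back the multiple of \<psi>
      recovers it for the potential, so the integral may be split.\<close>
    have "integrable ?\<sigma> (\<lambda>y. fundamental_solution (z + real (n + N) *\<^sub>R v - y) * \<psi> y)"
      using Bochner_Integration.integrable_add[OF int[of n] integrable_mult_right[OF \<psi>, of "ln (real (n + N) * norm v) / (2 * pi)"]]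
      by simp
    then show ?thesis using \<psi> by (simp add: single_layer_integral_def)
  qed
  ultimately have "(\<lambda>n. single_layer_integral \<Omega> \<psi> (z + real (n + N) *\<^sub>R v) -
      ln (real (n + N) * norm v) / (2 * pi) * (\<integral>y. \<psi> y \<partial>?\<sigma>)) \<longlonglongrightarrow> 0"
    by simp
  then show ?thesis by (rule LIMSEQ_offset)
qed

proposition single_layer_integral_exterior_zero:
  fixes v :: "'a::euclidean_space"
  assumes dim: "DIM('a) \<ge> 2" and \<Omega>: "bounded \<Omega>" "connected (- closure \<Omega>)"
    and fin: "finite_measure (surface_measure \<Omega>)"
    and \<psi>: "integrable (surface_measure \<Omega>) \<psi>" and v: "v \<noteq> 0"
    and zero: "\<And>z. z \<notin> closure \<Omega> \<Longrightarrow> (\<integral>y. dipole_kernel v (z - y) * \<psi> y \<partial>surface_measure \<Omega>) = 0"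
    and z: "z \<notin> closure \<Omega>"
  shows "single_layer_integral \<Omega> \<psi> z = 0"
proof -
  obtain R where R: "\<And>y. y \<in> closure \<Omega> \<Longrightarrow> norm y \<le> R"
    using bounded_closure[OF \<Omega>(1)] bounded_iff by blast
  \<comment> \<open>Rays from a general exterior point may run into the domain. This half space lies
    beyond it by Cauchy-Schwarz and contains every forward ray in direction \<open>v\<close> that
    starts in it.\<close>
  define H where "H = {w. w \<bullet> v > R * norm v}"
  have H_ext: "w \<notin> closure \<Omega>" if "w \<in> H" for w
  proof
    assume "w \<in> closure \<Omega>"
    then have "norm w * norm v \<le> R * norm v" using R by (intro mult_right_mono) auto
    moreover have "w \<bullet> v \<le> norm w * norm v" by (rule norm_cauchy_schwarz)
    ultimately show False using that by (simp add: H_def)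
  qed
  have H_ray: "w + s *\<^sub>R v \<in> H" if "w \<in> H" "s \<ge> 0" for w s
  proof -
    have "s * (v \<bullet> v) \<ge> 0" using that(2) by simp
    then show ?thesis using that(1) by (simp add: H_def inner_add_left)
  qed
  have H_zero: "single_layer_integral \<Omega> \<psi> w = 0" if w: "w \<in> H" for w
  proof -
    have const: "single_layer_integral \<Omega> \<psi> (w + t *\<^sub>R v) = single_layer_integral \<Omega> \<psi> w" if "t \<ge> 0" for t
    proof (rule single_layer_integral_line_const[OF dim \<Omega>(1) \<psi> _ _ that])
      fix s :: real assume "s \<ge> 0"
      then have "w + s *\<^sub>R v \<notin> closure \<Omega>" using H_ext H_ray w by blast
      then show "(\<integral>y. dipole_kernel v (w + s *\<^sub>R v - y) * \<psi> y \<partial>surface_measure \<Omega>) = 0"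
        and "w + s *\<^sub>R v \<notin> frontier \<Omega>"
        using zero by (auto simp: frontier_def)
    qed
    show ?thesis
    proof (cases "DIM('a) = 2")
      case False
      then have "(\<lambda>n. single_layer_integral \<Omega> \<psi> (w + real n *\<^sub>R v)) \<longlonglongrightarrow> 0"
        using dim by (intro single_layer_integral_decay[OF _ \<Omega>(1) \<psi> v]) simp
      then show ?thesis by (simp add: const LIMSEQ_const_iff)
    next
      case True
      define m where "m = (\<integral>y. \<psi> y \<partial>surface_measure \<Omega>)"
      have lim: "(\<lambda>n. single_layer_integral \<Omega> \<psi> w - ln (real n * norm v) / (2 * pi) * m) \<longlonglongrightarrow> 0"
        using single_layer_integral_log_growth[OF True \<Omega>(1) \<psi> v, of w] by (simp add: const m_def)
      have "m = 0"
      proof (rule ccontr)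
        assume "m \<noteq> 0"
        \<comment> \<open>Solved for the logarithm: this sequence equals
          \<open>ln (real n * norm v)\<close>, which would then have a finite limit.\<close>
        have "(\<lambda>n. (single_layer_integral \<Omega> \<psi> w - (single_layer_integral \<Omega> \<psi> w - ln (real n * norm v) / (2 * pi) * m)) * (2 * pi / m))
            \<longlonglongrightarrow> (single_layer_integral \<Omega> \<psi> w - 0) * (2 * pi / m)"
          by (intro tendsto_intros lim)
        then have "(\<lambda>n. ln (real n * norm v)) \<longlonglongrightarrow> single_layer_integral \<Omega> \<psi> w * (2 * pi / m)"
          using \<open>m \<noteq> 0\<close> by simp
        moreover have "filterlim (\<lambda>n. ln (real n * norm v)) at_top sequentially"
          using v by (intro filterlim_compose[OF ln_at_top]
              filterlim_at_top_mult_tendsto_pos[OF tendsto_const _ filterlim_real_sequentially]) simp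
        ultimately show False
          using not_tendsto_and_filterlim_at_infinity[OF sequentially_bot] filterlim_at_top_imp_at_infinity by blast
      qed
      then show ?thesis using lim by (simp add: LIMSEQ_const_iff)
    qed
  qed
  have "single_layer_integral \<Omega> \<psi> = (\<lambda>z. \<integral>y. fundamental_solution (z - y) * \<psi> y \<partial>surface_measure \<Omega>)"
    by (simp add: single_layer_integral_def fun_eq_iff)
  then have meas: "single_layer_integral \<Omega> \<psi> \<in> borel_measurable borel"
    using borel_measurable_potential[OF fin sets_surface_measure fundamental_solution_measurable
        borel_measurable_integrable[OF \<psi>]] by simp
  obtain kc where kc: "line_kernel (fundamental_solution :: 'a \<Rightarrow> real) kc"
    using line_kernel_fundamental_solution by blast
  have "line_analytic_on (single_layer_integral \<Omega> \<psi>) (- closure \<Omega>)"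
    unfolding single_layer_integral_def
    by (rule line_analytic_on_potential[OF kc compact_frontier_bounded[OF \<Omega>(1)] sets_surface_measure \<psi>])
      (auto simp: frontier_def)
  from line_analytic_on_identity[OF this meas]
  show ?thesis
  proof
    have "open H" unfolding H_def by (intro open_Collect_less continuous_intros)
    moreover have "H \<noteq> {}"
    proof -
      \<comment> \<open>The witness is the multiple of \<open>v\<close> of length |R| + 1. The
        absolute value is taken because \<open>R\<close> comes without a sign.\<close>
      have "(((\<bar>R\<bar> + 1) / norm v) *\<^sub>R v) \<bullet> v = (\<bar>R\<bar> + 1) * norm v"
        using v by (simp add: dot_square_norm power2_eq_square)
      also have "\<dots> > R * norm v" using v by (intro mult_strict_right_mono) auto
      finally have "((\<bar>R\<bar> + 1) / norm v) *\<^sub>R v \<in> H" unfolding H_def by (rule CollectI)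
      then show ?thesis by blast
    qed
    moreover have "H \<subseteq> {z \<in> - closure \<Omega>. single_layer_integral \<Omega> \<psi> z = 0}"
      using H_ext H_zero by blast
    ultimately show "\<not> negligible {z \<in> - closure \<Omega>. single_layer_integral \<Omega> \<psi> z = 0}"
      using open_not_negligible negligible_subset by blast
  qed (use \<Omega>(2) z in auto)
qed

text \<open>Provides the dominating function for the passage to the boundary. For d >= 3 the modulus
  decreases with distance, so A = c^(2 - d) and B = 0 suffice. The logarithm changes sign: it is
  bounded below through \<open>c\<close> and above through \<open>Q\<close>, at an additive
  cost.\<close>

lemma fundamental_solution_comparable:
  assumes dim: "DIM('a::euclidean_space) \<ge> 2" and "c > 0" "Q > 0"
  obtains A B where "A \<ge> 0" "B \<ge> 0"
    "\<And>(w::'a) (w'::'a). w \<noteq> 0 \<Longrightarrow> c * norm w \<le> norm w' \<Longrightarrow> norm w' \<le> Q \<Longrightarrow>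
       \<bar>fundamental_solution w'\<bar> \<le> A * \<bar>fundamental_solution w\<bar> + B"
proof (cases "DIM('a) = 2")
  case True
  show thesis
  proof (rule that[of 1 "(\<bar>ln c\<bar> + \<bar>ln Q\<bar>) / (2 * pi)"])
    fix w w' :: 'a assume w: "w \<noteq> 0" "c * norm w \<le> norm w'" "norm w' \<le> Q"
    have pos: "0 < c * norm w" "0 < norm w" using w \<open>c > 0\<close> by auto
    then have "norm w' > 0" using w by linarith
    then have "ln (norm w') \<le> ln Q" using w \<open>Q > 0\<close> by simp
    moreover have "ln c + ln (norm w) \<le> ln (norm w')"
      using w pos \<open>norm w' > 0\<close> \<open>c > 0\<close> by (metis ln_le_cancel_iff ln_mult_pos)
    ultimately have "\<bar>ln (norm w')\<bar> \<le> \<bar>ln (norm w)\<bar> + (\<bar>ln c\<bar> + \<bar>ln Q\<bar>)" by linarith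
    then have "\<bar>ln (norm w')\<bar> / (2 * pi) \<le> (\<bar>ln (norm w)\<bar> + (\<bar>ln c\<bar> + \<bar>ln Q\<bar>)) / (2 * pi)"
      by (intro divide_right_mono) auto
    then show "\<bar>fundamental_solution w'\<bar> \<le> 1 * \<bar>fundamental_solution w\<bar> + (\<bar>ln c\<bar> + \<bar>ln Q\<bar>) / (2 * pi)"
      using True by (simp add: fundamental_solution_def abs_mult add_divide_distrib)
  qed auto
next
  case False
  define a where "a = 2 - real DIM('a)"
  define k where "k = - 1 / (real DIM('a) * (real DIM('a) - 2) * unit_ball_vol (real DIM('a)))"
  have \<Gamma>: "fundamental_solution x = k * norm x powr a" for x :: 'a
    using False by (simp add: fundamental_solution_def k_def a_def)
  have a: "a \<le> 0" using dim by (simp add: a_def)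
  show thesis
  proof (rule that[of "c powr a" 0])
    fix w w' :: 'a assume w: "w \<noteq> 0" "c * norm w \<le> norm w'" "norm w' \<le> Q"
    have "norm w' powr a \<le> (c * norm w) powr a"
      using w \<open>c > 0\<close> by (intro powr_mono2' a) auto
    also have "\<dots> = c powr a * norm w powr a" using \<open>c > 0\<close> by (simp add: powr_mult)
    finally have "\<bar>k\<bar> * norm w' powr a \<le> \<bar>k\<bar> * (c powr a * norm w powr a)"
      by (intro mult_left_mono) auto
    then show "\<bar>fundamental_solution w'\<bar> \<le> c powr a * \<bar>fundamental_solution w\<bar> + 0"
      unfolding \<Gamma> by (simp add: abs_mult mult_ac)
  qed auto
qed

text \<open>
  Approaching the boundary point along \<open>- e\<close> is non-tangential, so the integrands are dominated
  by the integrand at \<open>x\<close>; if the latter is not integrable, the integral is \<open>0\<close> by convention.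
\<close>
proposition single_layer_integral_frontier_zero:
  fixes \<Omega> :: "'a::euclidean_space set"
  assumes dim: "DIM('a) \<ge> 2" and \<Omega>: "open \<Omega>" "bounded \<Omega>" "\<alpha> > 0" "C1_holder_boundary \<alpha> \<Omega>"
    and \<psi>: "integrable (surface_measure \<Omega>) \<psi>"
    and zero: "\<And>z. z \<notin> closure \<Omega> \<Longrightarrow> single_layer_integral \<Omega> \<psi> z = 0"
    and x: "x \<in> frontier \<Omega>"
  shows "single_layer_integral \<Omega> \<psi> x = 0"
proof (cases "integrable (surface_measure \<Omega>) (\<lambda>y. fundamental_solution (x - y) * \<psi> y)")
  case False
  then show ?thesis unfolding single_layer_integral_def by (rule not_integrable_integral_eq)
next
  case int: True
  let ?\<sigma> = "surface_measure \<Omega>"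
  obtain e r g L where "boundary_graph \<Omega> x e r g L"
    using boundary_graph_exists[OF \<Omega>(3,4) x \<Omega>(1)] .
  then interpret boundary_graph \<Omega> x e r g L .
  obtain R where R: "\<And>y. y \<in> frontier \<Omega> \<Longrightarrow> norm y \<le> R"
    using compact_imp_bounded[OF compact_frontier_bounded[OF \<Omega>(2)]] bounded_iff by blast
  have "R \<ge> 0" using R[OF x] norm_ge_zero[of x] by linarith
  \<comment> \<open>Starting at \<open>r / 2\<close> keeps all \<open>z n\<close> in the chart, and
    nearer to \<open>x\<close> than half the distance to any boundary point outside the
    chart.\<close>
  define t where "t n = r / 2 / real (Suc n)" for n
  have t_pos: "t n > 0" for n using r by (simp add: t_def)
  have t_le: "t n \<le> r / 2" for n
    using divide_left_mono[of 1 "real (Suc n)" "r / 2"] r by (simp add: t_def)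
  define z where "z n = x - t n *\<^sub>R e" for n
  have z_ext: "z n \<notin> closure \<Omega>" for n
  proof (rule below_graph_exterior)
    show "z n \<in> ball x r" using t_pos[of n] t_le[of n] r e by (simp add: z_def dist_norm)
    have ee: "e \<bullet> e = 1" using e by (simp add: dot_square_norm)
    then have ze: "z n \<bullet> e = x \<bullet> e - t n" by (simp add: z_def inner_diff_left)
    then have tan: "tangential e (z n) = tangential e x" by (simp add: z_def algebra_simps)
    have "x \<bullet> e = g (tangential e x)" using frontier_in_graph[OF x] r by simp
    then have "z n \<bullet> e < g (tangential e x)" using ze t_pos[of n] by linarith
    then show "z n \<bullet> e < g (tangential e (z n))" unfolding tan .
  qed
  \<comment> \<open>The factor \<open>1 + L\<close> comes from \<open>graph_bilipschitz\<close>, the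
    2 from \<open>norm_tangential_le\<close>. Boundary points outside the chart only need
    \<open>c \<le> 1 / 2\<close>.\<close>
  define c where "c = 1 / (2 * (1 + L))"
  have c: "c > 0" "c \<le> 1 / 2" using L by (simp_all add: c_def divide_simps)
  have lower: "c * norm (x - y) \<le> norm (z n - y)" if y: "y \<in> frontier \<Omega>" for n y
  proof (cases "y \<in> ball x r")
    case True
    have ee: "e \<bullet> e = 1" using e by (simp add: dot_square_norm)
    have "norm (x - y) \<le> (1 + L) * norm (tangential e (x - y))"
      using graph_bilipschitz[OF x _ y True] r by simp
    \<comment> \<open>Moving along \<open>e\<close> does not change the tangential component; this
      is what makes the approach non-tangential.\<close>
    also have "tangential e (x - y) = tangential e (z n - y)"
      using ee by (simp add: z_def inner_diff_left algebra_simps)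
    also have "(1 + L) * norm (tangential e (z n - y)) \<le> (1 + L) * (2 * norm (z n - y))"
      using L by (intro mult_left_mono norm_tangential_le[OF e]) auto
    finally have "c * norm (x - y) \<le> c * ((1 + L) * (2 * norm (z n - y)))"
      using c by (intro mult_left_mono) auto
    also have "\<dots> = norm (z n - y)"
    proof -
      have "0 < 1 + L" using L by linarith
      then have ne: "2 * (1 + L) \<noteq> 0" by simp
      have "c * (2 * (1 + L)) = 1"
        by (rule iffD1[OF nonzero_eq_divide_eq[OF ne] c_def])
      moreover have "c * ((1 + L) * (2 * norm (z n - y))) = c * (2 * (1 + L)) * norm (z n - y)"
        by (simp only: mult_ac)
      ultimately show ?thesis by simp
    qed
    finally show ?thesis .
  next
    case False
    \<comment> \<open>Outside the chart, |x - y| >= r, so the displacement is at most half the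
      distance and the triangle inequality suffices.\<close>
    then have "t n \<le> norm (x - y) / 2" using t_le[of n] by (simp add: dist_norm)
    moreover have "norm (x - y) \<le> norm (z n - y) + t n"
      using norm_triangle_ineq[of "z n - y" "t n *\<^sub>R e"] e t_pos[of n] by (simp add: z_def algebra_simps)
    moreover have "c * norm (x - y) \<le> 1 / 2 * norm (x - y)" using c by (intro mult_right_mono) auto
    ultimately show ?thesis by simp
  qed
  define Q where "Q = 2 * R + r"
  have upper: "norm (z n - y) \<le> Q" if "y \<in> frontier \<Omega>" for n y
  proof -
    have "norm (z n - y) \<le> norm x + norm (t n *\<^sub>R e) + norm y"
      unfolding z_def by (meson add_right_mono norm_triangle_ineq4 order_trans)
    then show ?thesis using R[OF x] R[OF that] t_le[of n] t_pos[of n] r e by (simp add: Q_def)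
  qed
  have "Q > 0" using r \<open>R \<ge> 0\<close> by (simp add: Q_def)
  obtain A B where "A \<ge> 0" "B \<ge> 0" and AB: "\<And>(w::'a) (w'::'a). w \<noteq> 0 \<Longrightarrow> c * norm w \<le> norm w' \<Longrightarrow> norm w' \<le> Q \<Longrightarrow>
       \<bar>fundamental_solution w'\<bar> \<le> A * \<bar>fundamental_solution w\<bar> + B"
    using fundamental_solution_comparable[OF dim c(1) \<open>Q > 0\<close>] by metis
  have "(\<lambda>n. \<integral>y. fundamental_solution (z n - y) * \<psi> y \<partial>?\<sigma>) \<longlonglongrightarrow> (\<integral>y. fundamental_solution (x - y) * \<psi> y \<partial>?\<sigma>)"
  proof (rule integral_dominated_convergence)
    show "(\<lambda>y. fundamental_solution (z n - y) * \<psi> y) \<in> borel_measurable ?\<sigma>" for n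
      by (intro borel_measurable_times measurable_kernel_surface_measure fundamental_solution_measurable
          borel_measurable_integrable[OF \<psi>])
    show "(\<lambda>y. fundamental_solution (x - y) * \<psi> y) \<in> borel_measurable ?\<sigma>"
      by (rule borel_measurable_integrable[OF int])
    show "integrable ?\<sigma> (\<lambda>y. A * \<bar>fundamental_solution (x - y) * \<psi> y\<bar> + B * \<bar>\<psi> y\<bar>)"
      by (intro Bochner_Integration.integrable_add integrable_mult_right integrable_abs \<psi> int)
    show "AE y in ?\<sigma>. (\<lambda>n. fundamental_solution (z n - y) * \<psi> y) \<longlonglongrightarrow> fundamental_solution (x - y) * \<psi> y"
      using AE_surface_measure_neq[OF dim, of x \<Omega>]
    proof eventually_elim
      case (elim y)
      have "t = (\<lambda>n. r / 2 * inverse (real (Suc n)))"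
        unfolding t_def[abs_def] by (simp only: divide_inverse)
      then have "t \<longlonglongrightarrow> 0"
        by (simp only: tendsto_mult_right_zero[OF LIMSEQ_inverse_real_of_nat])
      then have "(\<lambda>n. z n - y) \<longlonglongrightarrow> x - 0 *\<^sub>R e - y"
        unfolding z_def
        by (rule tendsto_diff[OF tendsto_diff[OF tendsto_const tendsto_scaleR[OF _ tendsto_const]] tendsto_const])
      moreover have "isCont fundamental_solution (x - y)"
        using GDERIV_fundamental_solution[OF dim, of "x - y"] elim
        unfolding gderiv_def by (auto dest: has_derivative_continuous)
      ultimately have "(\<lambda>n. fundamental_solution (z n - y)) \<longlonglongrightarrow> fundamental_solution (x - y)"
        by (intro isCont_tendsto_compose[of "x - y" fundamental_solution]) simp_all
      then show ?case by (rule tendsto_mult[OF _ tendsto_const])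
    qed
    show "AE y in ?\<sigma>. norm (fundamental_solution (z n - y) * \<psi> y) \<le> A * \<bar>fundamental_solution (x - y) * \<psi> y\<bar> + B * \<bar>\<psi> y\<bar>" for n
      using AE_surface_measure_neq[OF dim, of x \<Omega>] AE_space
    proof eventually_elim
      case (elim y)
      then have y: "y \<in> frontier \<Omega>" by (simp add: space_surface_measure)
      have "\<bar>fundamental_solution (z n - y)\<bar> \<le> A * \<bar>fundamental_solution (x - y)\<bar> + B"
        by (rule AB[OF _ lower[OF y] upper[OF y]]) (use elim in auto)
      then have "\<bar>fundamental_solution (z n - y)\<bar> * \<bar>\<psi> y\<bar> \<le> (A * \<bar>fundamental_solution (x - y)\<bar> + B) * \<bar>\<psi> y\<bar>"
        by (intro mult_right_mono) auto
      then show ?case by (simp add: abs_mult distrib_right mult.assoc)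
    qed
  qed
  moreover have "(\<integral>y. fundamental_solution (z n - y) * \<psi> y \<partial>?\<sigma>) = 0" for n
    using zero[OF z_ext[of n]] by (simp add: single_layer_integral_def)
  ultimately show ?thesis by (simp add: single_layer_integral_def LIMSEQ_const_iff)
qed

section \<open>Injectivity of the single layer potential and conclusion\<close>

lemma zero_in_Hm12: "(\<lambda>f. 0) \<in> Hm12 \<Omega>"
  by (auto simp: Hm12_def intro: exI[of _ 0])

lemma single_layer_potential_zero:
  assumes "is_single_layer_potential \<Omega> S"
  shows "AE x in surface_measure \<Omega>. S (\<lambda>f. 0) x = 0"
proof -
  have "\<forall>\<phi>\<in>Hm12 \<Omega>. \<forall>\<psi>\<in>Hm12 \<Omega>. \<forall>a b. AE x in surface_measure \<Omega>.
      S (\<lambda>f. a * \<phi> f + b * \<psi> f) x = a * S \<phi> x + b * S \<psi> x"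
    using assms unfolding is_single_layer_potential_def by (elim conjE)
  from this[rule_format, OF zero_in_Hm12 zero_in_Hm12, of 0 0] show ?thesis by simp
qed

text \<open>Invertibility is stated as unique solvability. For right-hand side 0 the zero functional
  is a solution, hence the only one.\<close>

lemma single_layer_potential_injective:
  fixes \<Omega> :: "'a::euclidean_space set"
  assumes "is_single_layer_potential \<Omega> S" "invertible_Hm12_H12 \<Omega> S" "\<phi> \<in> Hm12 \<Omega>"
    and "AE x in surface_measure \<Omega>. S \<phi> x = 0"
  shows "\<phi> = (\<lambda>f. 0)"
proof -
  have "(\<lambda>_. 0) \<in> H12 \<Omega>" by (simp add: H12_def H12_norm_sq_def)
  then have "\<exists>!\<phi>. \<phi> \<in> Hm12 \<Omega> \<and> (AE x in surface_measure \<Omega>. S \<phi> x = 0)"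
    using assms(2) unfolding invertible_Hm12_H12_def by blast
  then show ?thesis using assms single_layer_potential_zero[OF assms(1)] zero_in_Hm12 by blast
qed

proposition negligible_zeros_dipole_pairing:
  fixes \<Omega> :: "'a::euclidean_space set"
  assumes dim: "DIM('a) \<ge> 2" and \<Omega>: "open \<Omega>" "bounded \<Omega>" "\<alpha> > 0" "C1_holder_boundary \<alpha> \<Omega>"
    and ext: "connected (- closure \<Omega>)"
    and S: "is_single_layer_potential \<Omega> S" "invertible_Hm12_H12 \<Omega> S"
    and v: "v \<noteq> 0" and \<phi>: "\<phi> \<in> Hm12 \<Omega>" "\<phi> \<noteq> (\<lambda>f. 0)"
  shows "negligible {z \<in> - closure \<Omega>. np_inner S (density_functional \<Omega> (dipole_source v z)) \<phi> = 0}"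
proof (rule ccontr)
  assume nonnull: "\<not> ?thesis"
  let ?\<sigma> = "surface_measure \<Omega>"
  have fin: "finite_measure ?\<sigma>" by (rule finite_surface_measure[OF dim \<Omega>])
  define \<psi> where "\<psi> = S \<phi>"
  \<comment> \<open>Here the abstract functional is exchanged for a function: \<psi> may be tested
    by \<open>density_functional\<close> and is itself an L2 density for S.\<close>
  have \<psi>H: "\<psi> \<in> H12 \<Omega>" using S(1) \<phi> by (simp add: is_single_layer_potential_def \<psi>_def)
  then have \<psi>L: "\<psi> \<in> L2_bd \<Omega>" using H12_subset_L2_bd by blast
  have \<psi>: "integrable ?\<sigma> \<psi>" by (rule L2_bd_integrable[OF fin \<psi>L])
  define F where "F z = (\<integral>y. dipole_kernel v (z - y) * \<psi> y \<partial>?\<sigma>)" for z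
  have pairing: "np_inner S (density_functional \<Omega> (dipole_source v z)) \<phi> = - F z" if z: "z \<notin> closure \<Omega>" for z
  proof -
    have "(\<integral>y. dipole_source v z y * \<psi> y \<partial>?\<sigma>) = F z"
      unfolding F_def
    proof (intro Bochner_Integration.integral_cong refl)
      fix y assume "y \<in> space ?\<sigma>"
      then have "z \<noteq> y" using z by (auto simp: space_surface_measure frontier_def)
      then show "dipole_source v z y * \<psi> y = dipole_kernel v (z - y) * \<psi> y"
        by (simp add: dipole_source_eq[OF dim])
    qed
    then show ?thesis using \<psi>H by (simp add: np_inner_def density_functional_def flip: \<psi>_def)
  qed
  obtain kc where kc: "line_kernel (dipole_kernel v) kc" using line_kernel_dipole by blast
  have "line_analytic_on F (- closure \<Omega>)"
    unfolding F_def[abs_def]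
    by (rule line_analytic_on_potential[OF kc compact_frontier_bounded[OF \<Omega>(2)] sets_surface_measure \<psi>])
      (auto simp: frontier_def)
  moreover have "F \<in> borel_measurable borel"
    unfolding F_def[abs_def]
    by (rule borel_measurable_potential[OF fin sets_surface_measure dipole_kernel_measurable
          borel_measurable_integrable[OF \<psi>]])
  moreover have "{z \<in> - closure \<Omega>. np_inner S (density_functional \<Omega> (dipole_source v z)) \<phi> = 0} = {z \<in> - closure \<Omega>. F z = 0}"
    using pairing by auto
  ultimately have F0: "F z = 0" if "z \<notin> closure \<Omega>" for z
    using line_analytic_on_identity[of F "- closure \<Omega>" z] ext nonnull that by auto
  then have "single_layer_integral \<Omega> \<psi> z = 0" if "z \<notin> closure \<Omega>" for z
    using that unfolding F_def by (intro single_layer_integral_exterior_zero[OF dim \<Omega>(2) ext fin \<psi> v]) auto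
  then have bd: "single_layer_integral \<Omega> \<psi> x = 0" if "x \<in> frontier \<Omega>" for x
    by (rule single_layer_integral_frontier_zero[OF dim \<Omega> \<psi> _ that])
  have "AE x in ?\<sigma>. S (density_functional \<Omega> \<psi>) x = single_layer_integral \<Omega> \<psi> x"
    using S(1) \<psi>L by (simp add: is_single_layer_potential_def)
  then have "AE x in ?\<sigma>. S (density_functional \<Omega> \<psi>) x = 0"
    using AE_space by eventually_elim (simp add: bd space_surface_measure)
  then have "density_functional \<Omega> \<psi> = (\<lambda>f. 0)"
    by (rule single_layer_potential_injective[OF S density_functional_in_Hm12[OF fin \<psi>L]])
  \<comment> \<open>The vanishing functional is tested on its own density, which is admissible
    because \<psi> lies in \<open>H12 \<Omega>\<close>.\<close>
  from fun_cong[OF this, of \<psi>] have "(\<integral>x. \<psi> x * \<psi> x \<partial>?\<sigma>) = 0"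
    using \<psi>H by (simp add: density_functional_def)
  then have "AE x in ?\<sigma>. \<psi> x * \<psi> x = 0"
    using integral_nonneg_eq_0_iff_AE[OF L2_bd_integrable_mult[OF \<psi>L \<psi>L]] by simp
  then have "AE x in ?\<sigma>. S \<phi> x = 0" by (simp add: \<psi>_def)
  then show False using single_layer_potential_injective[OF S \<phi>(1)] \<phi>(2) by blast
qed

theorem theorem1p3:
  fixes \<Omega> :: "(real ^ 'n) set"
    and \<alpha> :: real
    and v :: "real ^ 'n"
    and S :: "((real ^ 'n \<Rightarrow> real) \<Rightarrow> real) \<Rightarrow> (real ^ 'n \<Rightarrow> real)"
    and K :: "((real ^ 'n \<Rightarrow> real) \<Rightarrow> real) \<Rightarrow> ((real ^ 'n \<Rightarrow> real) \<Rightarrow> real)"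
    and \<phi> :: "nat \<Rightarrow> ((real ^ 'n \<Rightarrow> real) \<Rightarrow> real)"
  assumes "CARD('n) \<ge> 2"
    and "bounded_domain \<Omega>"
    and "\<alpha> > 0"
    and "C1_holder_boundary \<alpha> \<Omega>"
    and connected_exterior: "connected (- closure \<Omega>)"
    and "is_single_layer_potential \<Omega> S"
    and "invertible_Hm12_H12 \<Omega> S"
    and "is_NP_operator \<Omega> K"
    and "v \<noteq> 0"
    and "orthogonal_eigensystem \<Omega> S K \<phi>"
  shows "AE z in lebesgue. z \<in> - closure \<Omega> \<longrightarrow>
           (\<forall>n\<ge>1. np_inner S (density_functional \<Omega> (dipole_source v z)) (\<phi> n) \<noteq> 0)"
proof -
  have dim: "DIM(real ^ 'n) \<ge> 2" using assms(1) by simp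
  have \<Omega>: "open \<Omega>" "bounded \<Omega>" using assms(2) by (auto simp: bounded_domain_def)
  \<comment> \<open>The condition \<open>n \<ge> 1\<close> is kept inside, so that the exceptional
    null sets can be united over all natural numbers.\<close>
  have "AE z in lebesgue. n \<ge> 1 \<longrightarrow> z \<in> - closure \<Omega> \<longrightarrow>
      np_inner S (density_functional \<Omega> (dipole_source v z)) (\<phi> n) \<noteq> 0" for n
  proof (cases "n \<ge> 1")
    case True
    then have "\<phi> n \<in> Hm12 \<Omega>" "\<phi> n \<noteq> (\<lambda>f. 0)"
      using assms(10) unfolding orthogonal_eigensystem_def by blast+
    then have "negligible {z \<in> - closure \<Omega>. np_inner S (density_functional \<Omega> (dipole_source v z)) (\<phi> n) = 0}"
      by (rule negligible_zeros_dipole_pairing[OF dim \<Omega> assms(3,4,5,6,7,9)])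
    then show ?thesis
      unfolding negligible_iff_null_sets by (rule AE_not_in[THEN AE_mp]) auto
  qed simp
  then have "AE z in lebesgue. \<forall>n. n \<ge> 1 \<longrightarrow> z \<in> - closure \<Omega> \<longrightarrow>
      np_inner S (density_functional \<Omega> (dipole_source v z)) (\<phi> n) \<noteq> 0"
    by (simp only: AE_all_countable simp_thms)
  then show ?thesis by eventually_elim blast
qed

end
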